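(* Let $T$ be a countable complete first-order theory with monster model $\mathcal{U}$, and let $M \prec \mathcal{U}$ be a small elementary submodel. Suppose $p \in S_x(\mathcal{U})$ is generically stable over $M$. Then there exists a sequence of points $(a_i)_{i\in\omega}$ in $M^x$ such that $\lim_{i\to\infty}\operatorname{tp}(a_i/\mathcal{U}) = p$ in $S_x(\mathcal{U})$.
   Context: $T$ is a complete first-order theory in a countable language, $\mathcal{U}$ is a monster model of $T$ (sufficiently saturated and strongly homogeneous), "small" means of cardinality smaller than the degree of saturation of $\mathcal{U}$, $x$ is a finite tuple of variables, and $M^x$ is the set of $|x|$-tuples from $M$. Convergence: a sequence of types $(p_i)_{i\in\omega}$ in $S_x(\mathcal{U})$ converges to $p$, written $\lim_{i\to\infty}p_i=p$, if it converges in the Stone topology; i.e. for every $\psi(x)\in p$ there is $n_\psi$ such that $\psi(x)\in p_n$ for all $n>n_\psi$. A type $p\in S_x(\mathcal{U})$ is invariant over $M$ if for every formula $\varphi(x,y)$ without parameters and all $b,b'\in\mathcal{U}^y$ with $\operatorname{tp}(b/M)=\operatorname{tp}(b'/M)$, $\varphi(x,b)\in p \iff \varphi(x,b')\in p$. A Morley sequence in an $M$-invariant type $p$ over $M$ is a sequence $(a_i)_{i\in\omega}$ in $\mathcal{U}^x$ with $a_i\models p|_{M a_0\dots a_{i-1}}$ for every $i\in\omega$. $p\in S_x(\mathcal{U})$ is generically stable over $M$ if $p$ is invariant over $M$ and for every Morley sequence $(a_i)_{i\in\omega}$ in $p$ over $M$, $\lim_{i\to\infty}\operatorname{tp}(a_i/\mathcal{U})=p$.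 *)

theory Defs
  imports "HOL-Analysis.Analysis"
begin

section \<open>First-order logic\<close>

text \<open>Constants are function symbols of arity 0.\<close>

record ('f, 'r) lang =
  funs :: "'f set"
  fun_ar :: "'f \<Rightarrow> nat"
  rels :: "'r set"
  rel_ar :: "'r \<Rightarrow> nat"

definition countable_lang :: "('f, 'r) lang \<Rightarrow> bool" where
  "countable_lang L \<longleftrightarrow> countable (funs L) \<and> countable (rels L)"

datatype 'f tm = Var nat | Fn 'f "'f tm list"

datatype ('f, 'r) fm =
    Eq "'f tm" "'f tm"
  | Rel 'r "'f tm list"
  | Neg "('f, 'r) fm"
  | Conj "('f, 'r) fm" "('f, 'r) fm"
  | Ex nat "('f, 'r) fm"

primrec wf_tm :: "('f, 'r) lang \<Rightarrow> 'f tm \<Rightarrow> bool" where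
  "wf_tm L (Var v) \<longleftrightarrow> True"
| "wf_tm L (Fn f ts) \<longleftrightarrow> f \<in> funs L \<and> length ts = fun_ar L f \<and> list_all id (map (wf_tm L) ts)"

primrec wf_fm :: "('f, 'r) lang \<Rightarrow> ('f, 'r) fm \<Rightarrow> bool" where
  "wf_fm L (Eq s t) \<longleftrightarrow> wf_tm L s \<and> wf_tm L t"
| "wf_fm L (Rel R ts) \<longleftrightarrow> R \<in> rels L \<and> length ts = rel_ar L R \<and> list_all (wf_tm L) ts"
| "wf_fm L (Neg \<phi>) \<longleftrightarrow> wf_fm L \<phi>"
| "wf_fm L (Conj \<phi> \<psi>) \<longleftrightarrow> wf_fm L \<phi> \<and> wf_fm L \<psi>"
| "wf_fm L (Ex v \<phi>) \<longleftrightarrow> wf_fm L \<phi>"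

primrec fv_tm :: "'f tm \<Rightarrow> nat set" where
  "fv_tm (Var v) = {v}"
| "fv_tm (Fn f ts) = \<Union> (set (map fv_tm ts))"

primrec fv :: "('f, 'r) fm \<Rightarrow> nat set" where
  "fv (Eq s t) = fv_tm s \<union> fv_tm t"
| "fv (Rel R ts) = \<Union> (set (map fv_tm ts))"
| "fv (Neg \<phi>) = fv \<phi>"
| "fv (Conj \<phi> \<psi>) = fv \<phi> \<union> fv \<psi>"
| "fv (Ex v \<phi>) = fv \<phi> - {v}"

text \<open>The finite tuple of variables \<open>x\<close> of length \<open>n\<close> is \<open>Var 0, \<dots>, Var (n - 1)\<close>; accordingly
  \<open>form L n\<close> is the set of \<open>L\<close>-formulas \<open>\<phi>(x)\<close>, and \<open>form L 0\<close> is the set of sentences.\<close>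

definition form :: "('f, 'r) lang \<Rightarrow> nat \<Rightarrow> ('f, 'r) fm set" where
  "form L n = {\<phi>. wf_fm L \<phi> \<and> fv \<phi> \<subseteq> {..<n}}"

definition tuples :: "'a set \<Rightarrow> nat \<Rightarrow> 'a list set" where
  "tuples A n = {a. length a = n \<and> set a \<subseteq> A}"

record ('f, 'r, 'a) struct =
  univ :: "'a set"
  fint :: "'f \<Rightarrow> 'a list \<Rightarrow> 'a"
  rint :: "'r \<Rightarrow> 'a list \<Rightarrow> bool"

definition is_struct :: "('f, 'r) lang \<Rightarrow> ('f, 'r, 'a) struct \<Rightarrow> bool" where
  "is_struct L N \<longleftrightarrow> univ N \<noteq> {} \<and>
     (\<forall>f \<in> funs L. \<forall>a \<in> tuples (univ N) (fun_ar L f). fint N f a \<in> univ N)"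

primrec val :: "('f, 'r, 'a) struct \<Rightarrow> (nat \<Rightarrow> 'a) \<Rightarrow> 'f tm \<Rightarrow> 'a" where
  "val N e (Var v) = e v"
| "val N e (Fn f ts) = fint N f (map (val N e) ts)"

primrec sat :: "('f, 'r, 'a) struct \<Rightarrow> (nat \<Rightarrow> 'a) \<Rightarrow> ('f, 'r) fm \<Rightarrow> bool" where
  "sat N e (Eq s t) \<longleftrightarrow> val N e s = val N e t"
| "sat N e (Rel R ts) \<longleftrightarrow> rint N R (map (val N e) ts)"
| "sat N e (Neg \<phi>) \<longleftrightarrow> \<not> sat N e \<phi>"
| "sat N e (Conj \<phi> \<psi>) \<longleftrightarrow> sat N e \<phi> \<and> sat N e \<psi>"
| "sat N e (Ex v \<phi>) \<longleftrightarrow> (\<exists>a \<in> univ N. sat N (e(v := a)) \<phi>)"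

text \<open>\<open>holds N a \<phi>\<close> is \<open>N \<Turnstile> \<phi>(a)\<close>. It is only used for \<open>\<phi> \<in> form L (length a)\<close>, so the
  unspecified values of \<open>a ! i\<close> for \<open>i \<ge> length a\<close> play no role.\<close>

definition holds :: "('f, 'r, 'a) struct \<Rightarrow> 'a list \<Rightarrow> ('f, 'r) fm \<Rightarrow> bool" where
  "holds N a \<phi> \<longleftrightarrow> sat N (\<lambda>i. a ! i) \<phi>"

definition models :: "('f, 'r, 'a) struct \<Rightarrow> ('f, 'r) fm set \<Rightarrow> bool" where
  "models N T \<longleftrightarrow> (\<forall>\<sigma> \<in> T. holds N [] \<sigma>)"

text \<open>HOL cannot quantify over models of every type. Since the language is countable, the downward
  Loewenheim-Skolem theorem allows the restriction to models with universe a set of naturals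
  in the next two definitions.\<close>

definition satisfiable :: "('f, 'r) lang \<Rightarrow> ('f, 'r) fm set \<Rightarrow> bool" where
  "satisfiable L T \<longleftrightarrow> (\<exists>N :: ('f, 'r, nat) struct. is_struct L N \<and> models N T)"

definition entails :: "('f, 'r) lang \<Rightarrow> ('f, 'r) fm set \<Rightarrow> ('f, 'r) fm \<Rightarrow> bool" where
  "entails L T \<sigma> \<longleftrightarrow>
     (\<forall>N :: ('f, 'r, nat) struct. is_struct L N \<and> models N T \<longrightarrow> holds N [] \<sigma>)"

definition complete_theory :: "('f, 'r) lang \<Rightarrow> ('f, 'r) fm set \<Rightarrow> bool" where
  "complete_theory L T \<longleftrightarrow> T \<subseteq> form L 0 \<and> satisfiable L T \<and>
     (\<forall>\<sigma> \<in> form L 0. entails L T \<sigma> \<or> entails L T (Neg \<sigma>))"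

definition substruct ::
    "('f, 'r) lang \<Rightarrow> ('f, 'r, 'a) struct \<Rightarrow> ('f, 'r, 'a) struct \<Rightarrow> bool" where
  "substruct L M N \<longleftrightarrow> is_struct L M \<and> is_struct L N \<and> univ M \<subseteq> univ N \<and>
     (\<forall>f \<in> funs L. \<forall>a \<in> tuples (univ M) (fun_ar L f). fint M f a = fint N f a) \<and>
     (\<forall>R \<in> rels L. \<forall>a \<in> tuples (univ M) (rel_ar L R). rint M R a = rint N R a)"

definition elem_substruct ::
    "('f, 'r) lang \<Rightarrow> ('f, 'r, 'a) struct \<Rightarrow> ('f, 'r, 'a) struct \<Rightarrow> bool" where
  "elem_substruct L M N \<longleftrightarrow> substruct L M N \<and>
     (\<forall>n. \<forall>\<phi> \<in> form L n. \<forall>a \<in> tuples (univ M) n. holds M a \<phi> \<longleftrightarrow> holds N a \<phi>)"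

definition automorphism ::
    "('f, 'r) lang \<Rightarrow> ('f, 'r, 'a) struct \<Rightarrow> ('a \<Rightarrow> 'a) \<Rightarrow> bool" where
  "automorphism L N g \<longleftrightarrow> bij_betw g (univ N) (univ N) \<and>
     (\<forall>f \<in> funs L. \<forall>a \<in> tuples (univ N) (fun_ar L f). g (fint N f a) = fint N f (map g a)) \<and>
     (\<forall>R \<in> rels L. \<forall>a \<in> tuples (univ N) (rel_ar L R). rint N R a \<longleftrightarrow> rint N R (map g a))"

definition partial_elementary ::
    "('f, 'r) lang \<Rightarrow> ('f, 'r, 'a) struct \<Rightarrow> 'a set \<Rightarrow> ('a \<Rightarrow> 'a) \<Rightarrow> bool" where
  "partial_elementary L N A g \<longleftrightarrow> A \<subseteq> univ N \<and> g ` A \<subseteq> univ N \<and>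
     (\<forall>n. \<forall>\<phi> \<in> form L n. \<forall>a \<in> tuples A n. holds N a \<phi> \<longleftrightarrow> holds N (map g a) \<phi>)"


section \<open>Types over parameter sets\<close>

text \<open>\<open>L(A)\<close>: the element \<open>a \<in> A\<close> becomes the constant symbol \<open>Inr a\<close>.\<close>

definition lang_with :: "('f, 'r) lang \<Rightarrow> 'a set \<Rightarrow> ('f + 'a, 'r) lang" where
  "lang_with L A = \<lparr>funs = funs L <+> A, fun_ar = case_sum (fun_ar L) (\<lambda>_. 0),
     rels = rels L, rel_ar = rel_ar L\<rparr>"

definition struct_with :: "('f, 'r, 'a) struct \<Rightarrow> ('f + 'a, 'r, 'a) struct" where
  "struct_with N = \<lparr>univ = univ N, fint = case_sum (fint N) (\<lambda>c _. c), rint = rint N\<rparr>"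

text \<open>Types over \<open>A \<subseteq> univ U\<close> in \<open>n\<close> variables, and the type \<open>tp(a/A)\<close>, both computed in \<open>U\<close>.
  Consistency with the theory of \<open>U\<close> with constants for \<open>A\<close> amounts to finite satisfiability
  in \<open>U\<close>.\<close>

definition type_space ::
    "('f, 'r) lang \<Rightarrow> ('f, 'r, 'a) struct \<Rightarrow> 'a set \<Rightarrow> nat \<Rightarrow> ('f + 'a, 'r) fm set set" where
  "type_space L U A n = {p. p \<subseteq> form (lang_with L A) n \<and>
     (\<forall>q. finite q \<and> q \<subseteq> p \<longrightarrow> (\<exists>a \<in> tuples (univ U) n. \<forall>\<phi> \<in> q. holds (struct_with U) a \<phi>)) \<and>
     (\<forall>\<phi> \<in> form (lang_with L A) n. \<phi> \<in> p \<or> Neg \<phi> \<in> p)}"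

definition tp ::
    "('f, 'r) lang \<Rightarrow> ('f, 'r, 'a) struct \<Rightarrow> 'a set \<Rightarrow> 'a list \<Rightarrow> ('f + 'a, 'r) fm set" where
  "tp L U A a = {\<phi> \<in> form (lang_with L A) (length a). holds (struct_with U) a \<phi>}"

definition realizes :: "('f, 'r, 'a) struct \<Rightarrow> 'a list \<Rightarrow> ('f + 'a, 'r) fm set \<Rightarrow> bool" where
  "realizes U a p \<longleftrightarrow> (\<forall>\<phi> \<in> p. holds (struct_with U) a \<phi>)"

definition type_restrict ::
    "('f, 'r) lang \<Rightarrow> nat \<Rightarrow> ('f + 'a, 'r) fm set \<Rightarrow> 'a set \<Rightarrow> ('f + 'a, 'r) fm set" where
  "type_restrict L n p A = p \<inter> form (lang_with L A) n"

definition stone :: "('f, 'r) lang \<Rightarrow> ('f, 'r, 'a) struct \<Rightarrow> 'a set \<Rightarrow> nat \<Rightarrow>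
    ('f + 'a, 'r) fm set topology" where
  "stone L U A n = topology_generated_by
     ((\<lambda>\<phi>. {p \<in> type_space L U A n. \<phi> \<in> p}) ` form (lang_with L A) n)"

definition type_lim :: "('f, 'r) lang \<Rightarrow> ('f, 'r, 'a) struct \<Rightarrow> nat \<Rightarrow>
    (nat \<Rightarrow> ('f + 'a, 'r) fm set) \<Rightarrow> ('f + 'a, 'r) fm set \<Rightarrow> bool" where
  "type_lim L U n P p \<longleftrightarrow> limitin (stone L U (univ U) n) P p sequentially"

lemma type_lim_iff:
  assumes p: "p \<in> type_space L U (univ U) n" and P: "\<And>i. P i \<in> type_space L U (univ U) n"
  shows "type_lim L U n P p \<longleftrightarrow> (\<forall>\<psi> \<in> p. \<exists>m. \<forall>i > m. \<psi> \<in> P i)"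
proof
  assume lim: "type_lim L U n P p"
  show "\<forall>\<psi> \<in> p. \<exists>m. \<forall>i > m. \<psi> \<in> P i"
  proof
    fix \<psi> assume \<psi>: "\<psi> \<in> p"
    let ?B = "{q \<in> type_space L U (univ U) n. \<psi> \<in> q}"
    have "\<psi> \<in> form (lang_with L (univ U)) n"
      using p \<psi> unfolding type_space_def by blast
    then have "openin (stone L U (univ U) n) ?B"
      unfolding stone_def by (intro topology_generated_by_Basis imageI)
    moreover have "p \<in> ?B"
      using p \<psi> by simp
    ultimately have "eventually (\<lambda>i. P i \<in> ?B) sequentially"
      using lim unfolding type_lim_def limitin_def by blast
    then show "\<exists>m. \<forall>i > m. \<psi> \<in> P i"
      unfolding eventually_sequentially by (metis (lifting) mem_Collect_eq less_imp_le)
  qed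
next
  assume R: "\<forall>\<psi> \<in> p. \<exists>m. \<forall>i > m. \<psi> \<in> P i"
  let ?F = "form (lang_with L (univ U)) n"
  let ?\<S> = "(\<lambda>\<phi>. {p \<in> type_space L U (univ U) n. \<phi> \<in> p}) ` ?F"
  have ev: "eventually (\<lambda>i. P i \<in> S) sequentially"
    if "generate_topology_on ?\<S> S" "p \<in> S" for S
    using that
  proof (induction rule: generate_topology_on.induct)
    case Empty
    then show ?case by simp
  next
    case (Int a b)
    then show ?case by (simp add: eventually_conj)
  next
    case (UN K)
    then obtain k where k: "k \<in> K" "p \<in> k" by blast
    then have "eventually (\<lambda>i. P i \<in> k) sequentially"
      using UN by blast
    then show ?case
      by (rule eventually_mono) (use k in blast)
  next
    case (Basis s)
    then obtain \<psi> where \<psi>: "s = {p \<in> type_space L U (univ U) n. \<psi> \<in> p}" by blast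
    then obtain m where "\<forall>i > m. \<psi> \<in> P i" using Basis R by blast
    then show ?case
      unfolding \<psi> eventually_sequentially using P by (metis (lifting) mem_Collect_eq Suc_le_eq)
  qed
  define \<tau> :: "('a + 'b, 'c) fm" where "\<tau> = Ex 0 (Eq (Var 0) (Var 0))"
  have \<tau>: "\<tau> \<in> ?F" by (simp add: \<tau>_def form_def)
  then have "Neg \<tau> \<in> ?F" by (simp add: form_def)
  moreover have "\<tau> \<in> p \<or> Neg \<tau> \<in> p"
    using p \<tau> unfolding type_space_def by blast
  ultimately have "p \<in> \<Union> ?\<S>"
    using p \<tau> by blast
  then show "type_lim L U n P p"
    unfolding type_lim_def limitin_def stone_def
    using ev by (simp add: openin_topology_generated_by_iff)
qed

lemma tp_in_type_space:
  assumes "a \<in> tuples (univ U) n"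
  shows "tp L U A a \<in> type_space L U A n"
  using assms unfolding tp_def type_space_def
  by (auto simp: tuples_def form_def holds_def intro!: bexI[of _ a])


section \<open>Monster models\<close>

text \<open>Cardinals are represented by cardinal orders \<open>\<kappa>\<close> as in the library.\<close>

definition small :: "'k rel \<Rightarrow> 'a set \<Rightarrow> bool" where
  "small \<kappa> A \<longleftrightarrow> (card_of A, \<kappa>) \<in> ordLess"

definition saturated :: "('f, 'r) lang \<Rightarrow> 'k rel \<Rightarrow> ('f, 'r, 'a) struct \<Rightarrow> bool" where
  "saturated L \<kappa> U \<longleftrightarrow> (\<forall>A n p. A \<subseteq> univ U \<and> small \<kappa> A \<and> p \<in> type_space L U A n \<longrightarrow>
     (\<exists>a \<in> tuples (univ U) n. realizes U a p))"

definition strongly_homogeneous ::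
    "('f, 'r) lang \<Rightarrow> 'k rel \<Rightarrow> ('f, 'r, 'a) struct \<Rightarrow> bool" where
  "strongly_homogeneous L \<kappa> U \<longleftrightarrow> (\<forall>A g. small \<kappa> A \<and> partial_elementary L U A g \<longrightarrow>
     (\<exists>h. automorphism L U h \<and> (\<forall>a \<in> A. h a = g a)))"

definition monster_model ::
    "('f, 'r) lang \<Rightarrow> ('f, 'r) fm set \<Rightarrow> 'k rel \<Rightarrow> ('f, 'r, 'a) struct \<Rightarrow> bool" where
  "monster_model L T \<kappa> U \<longleftrightarrow> is_struct L U \<and> models U T \<and>
     Card_order \<kappa> \<and> (natLeq, \<kappa>) \<in> ordLess \<and>
     saturated L \<kappa> U \<and> strongly_homogeneous L \<kappa> U"


section \<open>Generic stability\<close>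

text \<open>\<open>inst n b \<phi>\<close> is the formula \<open>\<phi>(x,b)\<close>, where \<open>\<phi>(x,y) \<in> form L (n + length b)\<close>,
  the tuple \<open>x\<close> is \<open>Var 0, \<dots>, Var (n - 1)\<close> and \<open>y\<close> is \<open>Var n, \<dots>, Var (n + length b - 1)\<close>.
  Only free occurrences are replaced.\<close>

primrec inst_tm :: "(nat \<Rightarrow> 'a option) \<Rightarrow> 'f tm \<Rightarrow> ('f + 'a) tm" where
  "inst_tm s (Var v) = (case s v of None \<Rightarrow> Var v | Some c \<Rightarrow> Fn (Inr c) [])"
| "inst_tm s (Fn f ts) = Fn (Inl f) (map (inst_tm s) ts)"

primrec inst_fm :: "(nat \<Rightarrow> 'a option) \<Rightarrow> ('f, 'r) fm \<Rightarrow> ('f + 'a, 'r) fm" where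
  "inst_fm s (Eq t u) = Eq (inst_tm s t) (inst_tm s u)"
| "inst_fm s (Rel R ts) = Rel R (map (inst_tm s) ts)"
| "inst_fm s (Neg \<phi>) = Neg (inst_fm s \<phi>)"
| "inst_fm s (Conj \<phi> \<psi>) = Conj (inst_fm s \<phi>) (inst_fm s \<psi>)"
| "inst_fm s (Ex v \<phi>) = Ex v (inst_fm (s(v := None)) \<phi>)"

definition inst :: "nat \<Rightarrow> 'a list \<Rightarrow> ('f, 'r) fm \<Rightarrow> ('f + 'a, 'r) fm" where
  "inst n b = inst_fm (\<lambda>v. if n \<le> v \<and> v < n + length b then Some (b ! (v - n)) else None)"

lemma val_inst_tm:
  "val (struct_with U) e (inst_tm s t) = val U (\<lambda>v. case s v of None \<Rightarrow> e v | Some c \<Rightarrow> c) t"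
proof (induction t)
  case (Var v)
  then show ?case by (simp add: struct_with_def split: option.split)
next
  case (Fn f ts)
  then show ?case by (simp add: struct_with_def cong: map_cong)
qed

lemma sat_inst_fm:
  "sat (struct_with U) e (inst_fm s \<phi>) \<longleftrightarrow> sat U (\<lambda>v. case s v of None \<Rightarrow> e v | Some c \<Rightarrow> c) \<phi>"
proof (induction \<phi> arbitrary: e s)
  case (Rel R ts)
  have "rint (struct_with U) = rint U" by (simp add: struct_with_def)
  then show ?case by (simp add: val_inst_tm o_def)
next
  case (Ex v \<phi>)
  have "(\<lambda>w. case (s(v := None)) w of None \<Rightarrow> (e(v := a)) w | Some c \<Rightarrow> c) =
      (\<lambda>w. case s w of None \<Rightarrow> e w | Some c \<Rightarrow> c)(v := a)" for a
    by (simp add: fun_eq_iff split: option.split)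
  moreover have "univ (struct_with U) = univ U" by (simp add: struct_with_def)
  ultimately show ?case by (simp only: inst_fm.simps sat.simps Ex.IH)
qed (simp_all add: val_inst_tm)

definition invariant_type :: "('f, 'r) lang \<Rightarrow> ('f, 'r, 'a) struct \<Rightarrow> 'a set \<Rightarrow> nat \<Rightarrow>
    ('f + 'a, 'r) fm set \<Rightarrow> bool" where
  "invariant_type L U A n p \<longleftrightarrow>
     (\<forall>m. \<forall>\<phi> \<in> form L (n + m). \<forall>b \<in> tuples (univ U) m. \<forall>b' \<in> tuples (univ U) m.
        tp L U A b = tp L U A b' \<longrightarrow> (inst n b \<phi> \<in> p \<longleftrightarrow> inst n b' \<phi> \<in> p))"

definition morley_sequence :: "('f, 'r) lang \<Rightarrow> ('f, 'r, 'a) struct \<Rightarrow> 'a set \<Rightarrow> nat \<Rightarrow>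
    ('f + 'a, 'r) fm set \<Rightarrow> (nat \<Rightarrow> 'a list) \<Rightarrow> bool" where
  "morley_sequence L U A n p a \<longleftrightarrow>
     (\<forall>i. a i \<in> tuples (univ U) n \<and>
          realizes U (a i) (type_restrict L n p (A \<union> (\<Union>j<i. set (a j)))))"

definition generically_stable :: "('f, 'r) lang \<Rightarrow> ('f, 'r, 'a) struct \<Rightarrow> 'a set \<Rightarrow> nat \<Rightarrow>
    ('f + 'a, 'r) fm set \<Rightarrow> bool" where
  "generically_stable L U A n p \<longleftrightarrow> invariant_type L U A n p \<and>
     (\<forall>a. morley_sequence L U A n p a \<longrightarrow> type_lim L U n (\<lambda>i. tp L U (univ U) (a i)) p)"

end

theory Submission
  imports Defs
begin

text \<open>
  Why the theorem holds. Write \<open>I\<close> for a Morley sequence \<open>a\<^sub>0, a\<^sub>1, \<dots>\<close> in \<open>p\<close> over \<open>M\<close>. Generic stability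
  says that a formula over \<open>U\<close> lies in \<open>p\<close> exactly if it holds at almost all entries of \<open>I\<close>, for every
  such \<open>I\<close> (\<open>generically_stable_in_type_iff\<close>). There are three steps.

  The restriction of \<open>p\<close> to \<open>M \<union> I\<close> is finitely satisfiable in \<open>M\<close> (\<open>witness_in_M\<close>). Let
  \<open>R(a\<^sub>0 \<dots> a\<^sub>k\<^sub>-\<^sub>1, x)\<close> be in \<open>p\<close> without a solution in \<open>M\<close>, and let \<open>e\<close> realize over \<open>M \<union> I\<close> a coheir of
  \<open>p\<restriction>M\<close>; then \<open>\<not>R(a\<^sub>0 \<dots> a\<^sub>k\<^sub>-\<^sub>1, e)\<close>. Finite satisfiability in \<open>M\<close> carries the indiscernibility of \<open>I\<close>
  over \<open>M\<close> to \<open>M e\<close>, and convergence then makes \<open>I\<close> a Morley sequence over \<open>M e\<close>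
  (\<open>morley_over_coheir\<close>). So \<open>e, a\<^sub>0, a\<^sub>1, \<dots>\<close> is a Morley sequence over \<open>M\<close>, and all Morley sequences have
  the same type over \<open>M\<close> (\<open>morley_same_type\<close>). For \<open>E\<close> a Morley sequence over \<open>M \<union> I\<close> this gives
  \<open>\<not>R(E\<^sub>0 \<dots> E\<^sub>k\<^sub>-\<^sub>1, a\<^sub>i)\<close> for all \<open>i\<close>, hence \<open>\<not>R(E\<^sub>0 \<dots> E\<^sub>k\<^sub>-\<^sub>1, x) \<in> p\<close>, against invariance.

  As the language is countable, points \<open>c\<^sub>0, c\<^sub>1, \<dots>\<close> of \<open>M\<close> can be chosen one after the other such that every
  formula of \<open>p\<close> over \<open>I\<close> and \<open>C = {c\<^sub>0, c\<^sub>1, \<dots>}\<close> holds at almost all \<open>c\<^sub>i\<close> (\<open>approximating_sequence\<close>).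

  This sequence converges to \<open>p\<close> over all of \<open>U\<close> (\<open>limit_of_sequence_in_M\<close>). Otherwise some
  \<open>\<psi>(x, b) \<in> p\<close> fails at infinitely many \<open>c\<^sub>i\<close>, and there is a global type \<open>q\<close>, finitely satisfiable in
  the \<open>c\<^sub>i\<close>, with \<open>\<not>\<psi>(x, b) \<in> q\<close> and with the same restriction to \<open>I \<union> C\<close> as \<open>p\<close>. Being finitely satisfiable
  in \<open>C\<close>, \<open>q\<close> is \<open>C\<close>-invariant, and \<open>I\<close> is a Morley sequence in \<open>q\<close> over \<open>C\<close>. Let \<open>e\<close> be a Morley sequence
  in \<open>q\<close> over \<open>M \<union> I \<union> {b}\<close> and \<open>E\<close> one in \<open>p\<close> over \<open>M \<union> I\<close>. Uniqueness of Morley sequences, used for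
  \<open>q\<close> over \<open>C\<close> and for \<open>p\<close> over \<open>M\<close>, shows that the initial segments of \<open>I, e\<close> and of \<open>I, E\<close> have the
  same types over the empty set, so an automorphism \<open>h\<close> fixes \<open>I\<close> and sends \<open>e\<close> to \<open>E\<close>. Now \<open>\<psi>(x, h b)\<close>
  holds at almost all \<open>a\<^sub>i\<close> and at no \<open>E\<^sub>i\<close>, although both sequences are Morley sequences in \<open>p\<close> over \<open>M\<close>.

  To keep syntax out of this argument, formulas over \<open>A\<close> are replaced by the predicates on tuples that they
  define (\<open>definable\<close>), and a type by the predicates that it contains (\<open>in_type\<close>).
\<close>

section \<open>Substitution and parameters in formulas\<close>

lemma struct_with_simps [simp]:
  "univ (struct_with N) = univ N"
  "fint (struct_with N) (Inl f) = fint N f"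
  "fint (struct_with N) (Inr c) cs = c"
  "rint (struct_with N) = rint N"
  by (simp_all add: struct_with_def)

lemma lang_with_simps [simp]:
  "funs (lang_with L A) = funs L <+> A"
  "fun_ar (lang_with L A) (Inl f) = fun_ar L f"
  "fun_ar (lang_with L A) (Inr c) = 0"
  "rels (lang_with L A) = rels L"
  "rel_ar (lang_with L A) = rel_ar L"
  by (simp_all add: lang_with_def)

lemma finite_fv_tm: "finite (fv_tm t)"
  by (induction t) auto

lemma finite_fv: "finite (fv \<phi>)"
  by (induction \<phi>) (auto simp: finite_fv_tm)

lemma val_cong: "(\<And>v. v \<in> fv_tm t \<Longrightarrow> e v = e' v) \<Longrightarrow> val N e t = val N e' t"
proof (induction t)
  case (Fn f ts)
  then have "map (val N e) ts = map (val N e') ts" by auto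
  then show ?case by (simp only: val.simps)
qed simp

lemma sat_cong: "(\<And>v. v \<in> fv \<phi> \<Longrightarrow> e v = e' v) \<Longrightarrow> sat N e \<phi> \<longleftrightarrow> sat N e' \<phi>"
proof (induction \<phi> arbitrary: e e')
  case (Eq s t)
  then have "val N e s = val N e' s" "val N e t = val N e' t"
    by (auto intro!: val_cong)
  then show ?case by simp
next
  case (Rel R ts)
  then have "map (val N e) ts = map (val N e') ts"
    by (auto intro!: val_cong)
  then show ?case by (simp only: sat.simps)
next
  case (Neg \<phi>)
  have "sat N e \<phi> = sat N e' \<phi>"
    using Neg.prems by (intro Neg.IH) simp
  then show ?case by simp
next
  case (Conj \<phi> \<psi>)
  have "sat N e \<phi> = sat N e' \<phi>" "sat N e \<psi> = sat N e' \<psi>"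
    using Conj.prems by (auto intro!: Conj.IH)
  then show ?case by simp
next
  case (Ex v \<phi>)
  have "sat N (e(v := a)) \<phi> = sat N (e'(v := a)) \<phi>" for a
    using Ex.prems by (intro Ex.IH) auto
  then show ?case by simp
qed

primrec rename_tm :: "(nat \<Rightarrow> nat) \<Rightarrow> 'f tm \<Rightarrow> 'f tm" where
  "rename_tm f (Var v) = Var (f v)"
| "rename_tm f (Fn g ts) = Fn g (map (rename_tm f) ts)"

text \<open>The bound variable is replaced by one above all images of free variables of the body, so that nothing is
  captured for any \<open>f\<close>, injective or not.\<close>

primrec rename :: "(nat \<Rightarrow> nat) \<Rightarrow> ('f, 'r) fm \<Rightarrow> ('f, 'r) fm" where
  "rename f (Eq s t) = Eq (rename_tm f s) (rename_tm f t)"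
| "rename f (Rel R ts) = Rel R (map (rename_tm f) ts)"
| "rename f (Neg \<phi>) = Neg (rename f \<phi>)"
| "rename f (Conj \<phi> \<psi>) = Conj (rename f \<phi>) (rename f \<psi>)"
| "rename f (Ex v \<phi>) = (let w = Suc (Max (insert 0 (f ` fv \<phi>))) in Ex w (rename (f(v := w)) \<phi>))"

lemma fv_rename_tm: "fv_tm (rename_tm f t) = f ` fv_tm t"
  by (induction t) auto

lemma wf_rename_tm: "wf_tm L t \<Longrightarrow> wf_tm L (rename_tm f t)"
  by (induction t) (auto simp: list_all_iff)

lemma val_rename_tm: "val N e (rename_tm f t) = val N (e \<circ> f) t"
  by (induction t) (auto simp: o_def cong: map_cong)

lemma fv_rename: "fv (rename f \<phi>) \<subseteq> f ` fv \<phi>"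
proof (induction \<phi> arbitrary: f)
  case (Ex v \<phi>)
  let ?w = "Suc (Max (insert 0 (f ` fv \<phi>)))"
  have "fv (rename (f(v := ?w)) \<phi>) \<subseteq> (f(v := ?w)) ` fv \<phi>" by (rule Ex)
  then show ?case by (auto simp: Let_def)
next
  case (Conj \<phi> \<psi>)
  show ?case using Conj.IH(1)[of f] Conj.IH(2)[of f] by (simp add: image_Un le_supI1 le_supI2)
qed (auto simp: fv_rename_tm)

lemma wf_rename: "wf_fm L \<phi> \<Longrightarrow> wf_fm L (rename f \<phi>)"
  by (induction \<phi> arbitrary: f) (simp_all add: wf_rename_tm list_all_iff Let_def)

lemma sat_rename: "sat N e (rename f \<phi>) \<longleftrightarrow> sat N (e \<circ> f) \<phi>"
proof (induction \<phi> arbitrary: e f)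
  case (Ex v \<phi>)
  let ?w = "Suc (Max (insert 0 (f ` fv \<phi>)))"
  have fresh: "f u \<noteq> ?w" if "u \<in> fv \<phi>" for u
  proof -
    have "f u \<le> Max (insert 0 (f ` fv \<phi>))"
      using that by (intro Max_ge) (auto simp: finite_fv)
    then show ?thesis by simp
  qed
  have "sat N (e(?w := a) \<circ> f(v := ?w)) \<phi> = sat N ((e \<circ> f)(v := a)) \<phi>" for a
    using fresh by (intro sat_cong) auto
  then show ?case by (simp only: rename.simps Let_def sat.simps Ex.IH)
next
  case (Rel R ts)
  show ?case by (simp add: val_rename_tm comp_def)
next
  case (Neg \<phi>)
  then show ?case by simp
next
  case (Conj \<phi> \<psi>)
  then show ?case by simp
qed (simp add: val_rename_tm)

lemma wf_inst_tm:
  assumes "wf_tm L t" and "\<And>v c. v \<in> fv_tm t \<Longrightarrow> s v = Some c \<Longrightarrow> c \<in> A"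
  shows "wf_tm (lang_with L A) (inst_tm s t)"
  using assms
proof (induction t)
  case (Fn f ts)
  then have "wf_tm (lang_with L A) (inst_tm s t)" if "t \<in> set ts" for t
    using that by (intro Fn.IH) (auto simp: list_all_iff)
  then show ?case using Fn.prems by (auto simp: lang_with_def list_all_iff)
qed (auto simp: lang_with_def split: option.splits)

lemma wf_inst_fm:
  assumes "wf_fm L \<phi>" and "\<And>v c. v \<in> fv \<phi> \<Longrightarrow> s v = Some c \<Longrightarrow> c \<in> A"
  shows "wf_fm (lang_with L A) (inst_fm s \<phi>)"
  using assms
proof (induction \<phi> arbitrary: s)
  case (Eq t u)
  then show ?case by (auto intro!: wf_inst_tm)
next
  case (Rel R ts)
  then have "wf_tm (lang_with L A) (inst_tm s t)" if "t \<in> set ts" for t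
    using that by (intro wf_inst_tm) (auto simp: list_all_iff)
  then show ?case using Rel by (auto simp: list_all_iff lang_with_def)
next
  case (Ex v \<phi>)
  have "wf_fm (lang_with L A) (inst_fm (s(v := None)) \<phi>)"
    using Ex.prems by (intro Ex.IH) (auto split: if_splits)
  then show ?case by simp
next
  case (Neg \<phi>)
  then show ?case by simp
next
  case (Conj \<phi> \<psi>)
  have "wf_fm (lang_with L A) (inst_fm s \<phi>)" "wf_fm (lang_with L A) (inst_fm s \<psi>)"
    using Conj.prems by (auto intro!: Conj.IH)
  then show ?case by simp
qed

lemma fv_inst_tm: "fv_tm (inst_tm s t) = {v \<in> fv_tm t. s v = None}"
  by (induction t) (auto split: option.splits)

lemma fv_inst_fm: "fv (inst_fm s \<phi>) = {v \<in> fv \<phi>. s v = None}"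
  by (induction \<phi> arbitrary: s) (auto simp: fv_inst_tm)

text \<open>Constants for parameters become variables. Variables go to even numbers and constants to odd ones,
  so no quantifier of the formula can capture a variable that stands for a constant.\<close>

primrec abstract_tm :: "('a \<Rightarrow> nat) \<Rightarrow> ('f + 'a) tm \<Rightarrow> 'f tm" where
  "abstract_tm k (Var v) = Var (2 * v)"
| "abstract_tm k (Fn f ts) =
     (case f of Inl g \<Rightarrow> Fn g (map (abstract_tm k) ts) | Inr c \<Rightarrow> Var (2 * k c + 1))"

primrec abstract_fm :: "('a \<Rightarrow> nat) \<Rightarrow> ('f + 'a, 'r) fm \<Rightarrow> ('f, 'r) fm" where
  "abstract_fm k (Eq s t) = Eq (abstract_tm k s) (abstract_tm k t)"
| "abstract_fm k (Rel R ts) = Rel R (map (abstract_tm k) ts)"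
| "abstract_fm k (Neg \<phi>) = Neg (abstract_fm k \<phi>)"
| "abstract_fm k (Conj \<phi> \<psi>) = Conj (abstract_fm k \<phi>) (abstract_fm k \<psi>)"
| "abstract_fm k (Ex v \<phi>) = Ex (2 * v) (abstract_fm k \<phi>)"

lemma wf_abstract_tm: "wf_tm (lang_with L A) t \<Longrightarrow> wf_tm L (abstract_tm k t)"
  by (induction t) (auto simp: lang_with_def list_all_iff split: sum.splits)

lemma wf_abstract_fm: "wf_fm (lang_with L A) \<phi> \<Longrightarrow> wf_fm L (abstract_fm k \<phi>)"
  by (induction \<phi>) (auto simp: wf_abstract_tm list_all_iff)

lemma finite_set_tm: "finite (set_tm t)"
  by (induction t) auto

lemma finite_set1_fm: "finite (set1_fm \<phi>)"
  by (induction \<phi>) (auto simp: finite_set_tm)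

lemma fv_abstract_tm:
  "w \<in> fv_tm (abstract_tm k t) \<Longrightarrow>
     (\<exists>v \<in> fv_tm t. w = 2 * v) \<or> (\<exists>c. Inr c \<in> set_tm t \<and> w = 2 * k c + 1)"
proof (induction t)
  case (Fn f ts)
  show ?case
  proof (cases f)
    case (Inl g)
    then obtain t where t: "t \<in> set ts" "w \<in> fv_tm (abstract_tm k t)"
      using Fn.prems by auto
    from Fn.IH[OF t] t(1) show ?thesis by auto
  next
    case (Inr c)
    then show ?thesis using Fn.prems by auto
  qed
qed simp

lemma fv_abstract_fm:
  "w \<in> fv (abstract_fm k \<phi>) \<Longrightarrow>
     (\<exists>v \<in> fv \<phi>. w = 2 * v) \<or> (\<exists>c. Inr c \<in> set1_fm \<phi> \<and> w = 2 * k c + 1)"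
proof (induction \<phi>)
  case (Eq s t)
  then show ?case using fv_abstract_tm[of w k s] fv_abstract_tm[of w k t] by auto
next
  case (Rel R ts)
  then obtain t where t: "t \<in> set ts" "w \<in> fv_tm (abstract_tm k t)" by auto
  from fv_abstract_tm[OF t(2)] t(1) show ?case by auto
next
  case (Ex v \<phi>)
  then show ?case by auto
qed auto

lemma val_abstract_tm:
  assumes "\<And>c. Inr c \<in> set_tm t \<Longrightarrow> e (2 * k c + 1) = c"
  shows "val N e (abstract_tm k t) = val (struct_with N) (\<lambda>v. e (2 * v)) t"
  using assms
proof (induction t)
  case (Fn f ts)
  have "val N e (abstract_tm k t) = val (struct_with N) (\<lambda>v. e (2 * v)) t" if "t \<in> set ts" for t
    using that Fn.prems by (intro Fn.IH) auto
  then have "map (val N e) (map (abstract_tm k) ts) = map (val (struct_with N) (\<lambda>v. e (2 * v))) ts"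
    by simp
  with Fn.prems show ?case
    by (cases f) (auto simp: comp_def cong: map_cong)
qed simp

lemma sat_abstract_fm:
  assumes "\<And>c. Inr c \<in> set1_fm \<phi> \<Longrightarrow> e (2 * k c + 1) = c"
  shows "sat N e (abstract_fm k \<phi>) \<longleftrightarrow> sat (struct_with N) (\<lambda>v. e (2 * v)) \<phi>"
  using assms
proof (induction \<phi> arbitrary: e)
  case (Eq s t)
  have "val N e (abstract_tm k s) = val (struct_with N) (\<lambda>v. e (2 * v)) s"
    "val N e (abstract_tm k t) = val (struct_with N) (\<lambda>v. e (2 * v)) t"
    using Eq by (auto intro!: val_abstract_tm)
  then show ?case by simp
next
  case (Rel R ts)
  have "val N e (abstract_tm k t) = val (struct_with N) (\<lambda>v. e (2 * v)) t" if "t \<in> set ts" for t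
    using that Rel.prems by (intro val_abstract_tm) auto
  then have "map (val N e) (map (abstract_tm k) ts) = map (val (struct_with N) (\<lambda>v. e (2 * v))) ts"
    by simp
  then show ?case by (simp add: comp_def cong: map_cong)
next
  case (Neg \<phi>)
  have "sat N e (abstract_fm k \<phi>) \<longleftrightarrow> sat (struct_with N) (\<lambda>v. e (2 * v)) \<phi>"
    using Neg.prems by (intro Neg.IH) simp
  then show ?case by simp
next
  case (Conj \<phi> \<psi>)
  have "sat N e (abstract_fm k \<phi>) \<longleftrightarrow> sat (struct_with N) (\<lambda>v. e (2 * v)) \<phi>"
    using Conj.prems by (intro Conj.IH) simp
  moreover have "sat N e (abstract_fm k \<psi>) \<longleftrightarrow> sat (struct_with N) (\<lambda>v. e (2 * v)) \<psi>"
    using Conj.prems by (intro Conj.IH) simp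
  ultimately show ?case by simp
next
  case (Ex v \<phi>)
  have "(\<lambda>u. (e(2 * v := a)) (2 * u)) = (\<lambda>u. e (2 * u))(v := a)" for a
    by (rule ext) simp
  moreover have "sat N (e(2 * v := a)) (abstract_fm k \<phi>) \<longleftrightarrow>
      sat (struct_with N) (\<lambda>u. (e(2 * v := a)) (2 * u)) \<phi>" for a
  proof (rule Ex.IH)
    fix c assume "Inr c \<in> set1_fm \<phi>"
    moreover have "2 * k c + 1 \<noteq> 2 * v" by presburger
    ultimately show "(e(2 * v := a)) (2 * k c + 1) = c"
      using Ex.prems by simp
  qed
  ultimately show ?case by (simp only: abstract_fm.simps sat.simps struct_with_simps)
qed

lemma wf_tm_constants:
  "wf_tm (lang_with L A) t \<longleftrightarrow> wf_tm (lang_with L UNIV) t \<and> (\<forall>c. Inr c \<in> set_tm t \<longrightarrow> c \<in> A)"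
proof (induction t)
  case (Fn f ts)
  then have "(\<forall>t \<in> set ts. wf_tm (lang_with L A) t) \<longleftrightarrow> (\<forall>t \<in> set ts. wf_tm (lang_with L UNIV) t) \<and>
      (\<forall>c. (\<exists>t \<in> set ts. Inr c \<in> set_tm t) \<longrightarrow> c \<in> A)"
    by blast
  then show ?case by (cases f) (auto simp: list_all_iff)
qed simp

lemma wf_fm_constants:
  "wf_fm (lang_with L A) \<phi> \<longleftrightarrow> wf_fm (lang_with L UNIV) \<phi> \<and> (\<forall>c. Inr c \<in> set1_fm \<phi> \<longrightarrow> c \<in> A)"
proof (induction \<phi>)
  case (Eq s t)
  then show ?case using wf_tm_constants[of L A s] wf_tm_constants[of L A t] by auto
next
  case (Rel R ts)
  have "(\<forall>t \<in> set ts. wf_tm (lang_with L A) t) \<longleftrightarrow> (\<forall>t \<in> set ts. wf_tm (lang_with L UNIV) t) \<and>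
      (\<forall>c. (\<exists>t \<in> set ts. Inr c \<in> set_tm t) \<longrightarrow> c \<in> A)"
    using wf_tm_constants[of L A] by blast
  then show ?case by (auto simp: list_all_iff)
qed auto

lemma form_mono: "A \<subseteq> B \<Longrightarrow> form (lang_with L A) n \<subseteq> form (lang_with L B) n"
  using wf_fm_constants[of L A] wf_fm_constants[of L B] unfolding form_def by blast

lemma form_finite_constants:
  assumes "\<phi> \<in> form (lang_with L A) n"
  obtains F where "finite F" "F \<subseteq> A" "\<phi> \<in> form (lang_with L F) n"
proof
  let ?F = "{c. Inr c \<in> set1_fm \<phi>}"
  have "finite (Inr -` set1_fm \<phi>)" by (intro finite_vimageI) (auto simp: finite_set1_fm)
  then show "finite ?F" by (simp add: vimage_def)
  show "?F \<subseteq> A" "\<phi> \<in> form (lang_with L ?F) n"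
    using assms wf_fm_constants[of L A \<phi>] wf_fm_constants[of L ?F \<phi>] unfolding form_def by auto
qed

instance tm :: (countable) countable
  by countable_datatype

instance fm :: (countable, countable) countable
  by countable_datatype

lemma wf_tm_symbols: "wf_tm L t \<Longrightarrow> set_tm t \<subseteq> funs L"
  by (induction t) (auto simp: list_all_iff)

lemma wf_fm_symbols: "wf_fm L \<phi> \<Longrightarrow> set1_fm \<phi> \<subseteq> funs L \<and> set2_fm \<phi> \<subseteq> rels L"
  by (induction \<phi>) (auto simp: list_all_iff dest!: wf_tm_symbols)

lemma countable_form:
  assumes "countable_lang L"
  shows "countable (form L n)"
proof -
  have "inj_on (map_fm (to_nat_on (funs L)) (to_nat_on (rels L))) (form L n)"
  proof (rule inj_onI)
    fix \<phi> \<psi> assume *: "\<phi> \<in> form L n" "\<psi> \<in> form L n"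
      "map_fm (to_nat_on (funs L)) (to_nat_on (rels L)) \<phi> =
       map_fm (to_nat_on (funs L)) (to_nat_on (rels L)) \<psi>"
    have "inj_on (to_nat_on (funs L)) (funs L)" "inj_on (to_nat_on (rels L)) (rels L)"
      using assms by (auto simp: countable_lang_def)
    then show "\<phi> = \<psi>"
      using * wf_fm_symbols[of L \<phi>] wf_fm_symbols[of L \<psi>]
      by (intro fm.inj_map_strong[OF _ _ *(3)]) (auto simp: form_def dest: inj_onD)
  qed
  then show ?thesis
    by (rule countable_image_inj_on[rotated]) simp
qed

lemma countable_form_lang_with:
  assumes "countable_lang L" "countable A"
  shows "countable (form (lang_with L A) n)"
  using assms by (intro countable_form) (auto simp: countable_lang_def lang_with_def)

lemma sat_foldr_Ex:
  "sat N e (foldr Ex [m..<m + n] \<phi>) \<longleftrightarrow>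
     (\<exists>a \<in> tuples (univ N) n. sat N (\<lambda>v. if m \<le> v \<and> v < m + n then a ! (v - m) else e v) \<phi>)"
proof (induction n arbitrary: \<phi>)
  case 0
  have upd: "(\<lambda>v. if m \<le> v \<and> v < m + 0 then a ! (v - m) else e v) = e" for a
    by (auto simp: fun_eq_iff)
  have "tuples (univ N) 0 = {[]}" by (auto simp: tuples_def)
  then show ?case unfolding upd by simp
next
  case (Suc n)
  define u where "u a v = (if m \<le> v \<and> v < m + n then a ! (v - m) else e v)" for a v
  define u' where "u' a v = (if m \<le> v \<and> v < m + Suc n then a ! (v - m) else e v)" for a v
  have upd: "(u a)(m + n := c) = u' (a @ [c])" if "a \<in> tuples (univ N) n" for a c
    using that by (auto simp: u_def u'_def tuples_def nth_append fun_eq_iff)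
  have "sat N e (foldr Ex [m..<m + Suc n] \<phi>) \<longleftrightarrow> sat N e (foldr Ex [m..<m + n] (Ex (m + n) \<phi>))"
    by simp
  also have "\<dots> \<longleftrightarrow> (\<exists>a \<in> tuples (univ N) n. \<exists>c \<in> univ N. sat N ((u a)(m + n := c)) \<phi>)"
    unfolding Suc.IH u_def by simp
  also have "\<dots> \<longleftrightarrow> (\<exists>a \<in> tuples (univ N) n. \<exists>c \<in> univ N. sat N (u' (a @ [c])) \<phi>)"
    by (simp add: upd)
  also have "\<dots> \<longleftrightarrow> (\<exists>a \<in> tuples (univ N) (Suc n). sat N (u' a) \<phi>)"
  proof
    assume "\<exists>a \<in> tuples (univ N) n. \<exists>c \<in> univ N. sat N (u' (a @ [c])) \<phi>"
    then obtain a c where "a \<in> tuples (univ N) n" "c \<in> univ N" "sat N (u' (a @ [c])) \<phi>"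
      by blast
    then show "\<exists>a \<in> tuples (univ N) (Suc n). sat N (u' a) \<phi>"
      by (intro bexI[of _ "a @ [c]"]) (auto simp: tuples_def)
  next
    assume "\<exists>a \<in> tuples (univ N) (Suc n). sat N (u' a) \<phi>"
    then obtain a where a: "length a = Suc n" "set a \<subseteq> univ N" "sat N (u' a) \<phi>"
      by (auto simp: tuples_def)
    then obtain b c where bc: "a = b @ [c]" by (cases a rule: rev_cases) auto
    then have "b \<in> tuples (univ N) n" "c \<in> univ N" "sat N (u' (b @ [c])) \<phi>"
      using a by (auto simp: tuples_def)
    then show "\<exists>a \<in> tuples (univ N) n. \<exists>c \<in> univ N. sat N (u' (a @ [c])) \<phi>"
      by blast
  qed
  finally show ?case unfolding u'_def .
qed

lemma fv_foldr_Ex: "fv (foldr Ex vs \<phi>) = fv \<phi> - set vs"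
  by (induction vs) auto

lemma wf_foldr_Ex: "wf_fm L (foldr Ex vs \<phi>) = wf_fm L \<phi>"
  by (induction vs) auto

lemma val_automorphism:
  assumes g: "automorphism L N g" and N: "is_struct L N" and e: "\<And>v. e v \<in> univ N"
    and t: "wf_tm L t"
  shows "val N e t \<in> univ N \<and> g (val N e t) = val N (g \<circ> e) t"
  using t
proof (induction t)
  case (Var v)
  then show ?case using e by simp
next
  case (Fn f ts)
  have ts: "val N e t \<in> univ N \<and> g (val N e t) = val N (g \<circ> e) t" if "t \<in> set ts" for t
    using that Fn.prems by (intro Fn.IH) (auto simp: list_all_iff)
  have f: "f \<in> funs L" and args: "map (val N e) ts \<in> tuples (univ N) (fun_ar L f)"
    using ts Fn.prems by (auto simp: tuples_def)
  have "map g (map (val N e) ts) = map (val N (g \<circ> e)) ts"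
    using ts by simp
  moreover have "g (fint N f (map (val N e) ts)) = fint N f (map g (map (val N e) ts))"
    using g f args unfolding automorphism_def by blast
  moreover have "fint N f (map (val N e) ts) \<in> univ N"
    using N f args unfolding is_struct_def by blast
  ultimately show ?case by (simp only: val.simps simp_thms)
qed

lemma sat_automorphism:
  assumes g: "automorphism L N g" and N: "is_struct L N" and e: "\<And>v. e v \<in> univ N"
    and \<phi>: "wf_fm L \<phi>"
  shows "sat N (g \<circ> e) \<phi> \<longleftrightarrow> sat N e \<phi>"
  using e \<phi>
proof (induction \<phi> arbitrary: e)
  case (Eq s t)
  then have "val N e s \<in> univ N \<and> g (val N e s) = val N (g \<circ> e) s"
    "val N e t \<in> univ N \<and> g (val N e t) = val N (g \<circ> e) t"
    using val_automorphism[OF g N] by simp_all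
  moreover have "inj_on g (univ N)"
    using g unfolding automorphism_def bij_betw_def by blast
  ultimately show ?case by (metis inj_onD sat.simps(1))
next
  case (Rel R ts)
  have ts: "val N e t \<in> univ N \<and> g (val N e t) = val N (g \<circ> e) t" if "t \<in> set ts" for t
    using that Rel.prems by (intro val_automorphism[OF g N]) (auto simp: list_all_iff)
  have "R \<in> rels L" and "map (val N e) ts \<in> tuples (univ N) (rel_ar L R)"
    using ts Rel.prems by (auto simp: tuples_def)
  then have "rint N R (map (val N e) ts) \<longleftrightarrow> rint N R (map g (map (val N e) ts))"
    using g unfolding automorphism_def by blast
  moreover have "map g (map (val N e) ts) = map (val N (g \<circ> e)) ts"
    using ts by simp
  ultimately show ?case by (simp only: sat.simps)
next
  case (Ex v \<phi>)
  have surj: "g ` univ N = univ N"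
    using g unfolding automorphism_def bij_betw_def by blast
  have step: "sat N ((g \<circ> e)(v := g a)) \<phi> \<longleftrightarrow> sat N (e(v := a)) \<phi>" if "a \<in> univ N" for a
  proof -
    have "sat N (g \<circ> e(v := a)) \<phi> \<longleftrightarrow> sat N (e(v := a)) \<phi>"
      using that Ex.prems by (intro Ex.IH) auto
    moreover have "g \<circ> e(v := a) = (g \<circ> e)(v := g a)" by auto
    ultimately show ?thesis by simp
  qed
  have "(\<exists>a \<in> univ N. sat N ((g \<circ> e)(v := a)) \<phi>) \<longleftrightarrow> (\<exists>a \<in> univ N. sat N ((g \<circ> e)(v := g a)) \<phi>)"
    by (subst surj[symmetric]) blast
  then show ?case using step by (simp only: sat.simps cong: bex_cong)
next
  case (Neg \<phi>)
  then show ?case by simp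
next
  case (Conj \<phi> \<psi>)
  then show ?case by simp
qed

lemma tuplesD: "a \<in> tuples A n \<Longrightarrow> length a = n" "a \<in> tuples A n \<Longrightarrow> set a \<subseteq> A"
  by (simp_all add: tuples_def)

lemma tuples_mono: "A \<subseteq> B \<Longrightarrow> tuples A n \<subseteq> tuples B n"
  by (auto simp: tuples_def)

lemma tuples_append: "a \<in> tuples A m \<Longrightarrow> b \<in> tuples A n \<Longrightarrow> a @ b \<in> tuples A (m + n)"
  by (auto simp: tuples_def)

lemma holds_cong:
  assumes "\<phi> \<in> form L n" and "\<And>i. i < n \<Longrightarrow> e i = a ! i"
  shows "sat N e \<phi> \<longleftrightarrow> holds N a \<phi>"
  unfolding holds_def using assms by (intro sat_cong) (auto simp: form_def)

locale fo_structure =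
  fixes L :: "('f, 'r) lang" and U :: "('f, 'r, 'a) struct"
  assumes struct: "is_struct L U"
begin

section \<open>Definable predicates\<close>

definition definable :: "'a set \<Rightarrow> nat \<Rightarrow> ('a list \<Rightarrow> bool) \<Rightarrow> bool" where
  "definable A n Q \<longleftrightarrow> (\<exists>\<psi> \<in> form (lang_with L A) n. \<forall>a \<in> tuples (univ U) n.
     Q a \<longleftrightarrow> holds (struct_with U) a \<psi>)"

lemma definable_cong:
  "(\<And>a. a \<in> tuples (univ U) n \<Longrightarrow> Q a \<longleftrightarrow> Q' a) \<Longrightarrow> definable A n Q \<longleftrightarrow> definable A n Q'"
  unfolding definable_def by simp

lemma definable_mono: "A \<subseteq> B \<Longrightarrow> definable A n Q \<Longrightarrow> definable B n Q"
  unfolding definable_def using form_mono by blast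

lemma definable_holds: "\<psi> \<in> form (lang_with L A) n \<Longrightarrow> definable A n (\<lambda>a. holds (struct_with U) a \<psi>)"
  unfolding definable_def by blast

lemma definable_finite:
  assumes "definable A n Q"
  obtains F where "finite F" "F \<subseteq> A" "definable F n Q"
  using assms form_finite_constants unfolding definable_def by metis

lemma definable_not: "definable A n Q \<Longrightarrow> definable A n (\<lambda>a. \<not> Q a)"
  unfolding definable_def
proof (elim bexE)
  fix \<psi> assume "\<psi> \<in> form (lang_with L A) n"
    "\<forall>a \<in> tuples (univ U) n. Q a \<longleftrightarrow> holds (struct_with U) a \<psi>"
  then show "\<exists>\<psi> \<in> form (lang_with L A) n. \<forall>a \<in> tuples (univ U) n. \<not> Q a \<longleftrightarrow> holds (struct_with U) a \<psi>"
    by (intro bexI[of _ "Neg \<psi>"]) (auto simp: holds_def form_def)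
qed

lemma definable_conj:
  assumes "definable A n Q" "definable A n R"
  shows "definable A n (\<lambda>a. Q a \<and> R a)"
proof -
  obtain \<psi> \<theta> where "\<psi> \<in> form (lang_with L A) n" "\<theta> \<in> form (lang_with L A) n"
    "\<And>a. a \<in> tuples (univ U) n \<Longrightarrow> Q a \<longleftrightarrow> holds (struct_with U) a \<psi>"
    "\<And>a. a \<in> tuples (univ U) n \<Longrightarrow> R a \<longleftrightarrow> holds (struct_with U) a \<theta>"
    using assms unfolding definable_def by blast
  then show ?thesis
    unfolding definable_def by (intro bexI[of _ "Conj \<psi> \<theta>"]) (auto simp: holds_def form_def)
qed

lemma definable_True: "definable A n (\<lambda>a. True)"
proof -
  have "Ex 0 (Eq (Var 0) (Var 0)) \<in> form (lang_with L A) n"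
    by (simp add: form_def)
  moreover have "univ U \<noteq> {}" using struct by (simp add: is_struct_def)
  ultimately show ?thesis
    unfolding definable_def by (intro bexI[of _ "Ex 0 (Eq (Var 0) (Var 0))"]) (auto simp: holds_def)
qed

lemma definable_finite_all:
  assumes "finite I" and "\<And>i. i \<in> I \<Longrightarrow> definable A n (Q i)"
  shows "definable A n (\<lambda>a. \<forall>i \<in> I. Q i a)"
  using assms
proof (induction I)
  case empty
  then show ?case by (simp add: definable_True)
next
  case (insert i I)
  then have "definable A n (\<lambda>a. Q i a \<and> (\<forall>i \<in> I. Q i a))"
    by (intro definable_conj) auto
  then show ?case by simp
qed

text \<open>The normal form behind all closure properties of definable predicates: an \<open>L\<close>-formula together with
  an assignment \<open>h\<close> of each of its variables to a coordinate of the tuple or to a parameter. Substitutions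
  then act on \<open>h\<close> alone.\<close>

lemma definable_iff:
  "definable A n Q \<longleftrightarrow> (\<exists>\<phi> h. wf_fm L \<phi> \<and> (\<forall>v \<in> fv \<phi>. h v \<in> {..<n} <+> A) \<and>
     (\<forall>a \<in> tuples (univ U) n. Q a \<longleftrightarrow> sat U (case_sum (nth a) id \<circ> h) \<phi>))"
    (is "_ \<longleftrightarrow> ?R")
proof
  assume "definable A n Q"
  then obtain \<psi> where \<psi>: "\<psi> \<in> form (lang_with L A) n"
    and Q: "\<And>a. a \<in> tuples (univ U) n \<Longrightarrow> Q a \<longleftrightarrow> holds (struct_with U) a \<psi>"
    unfolding definable_def by blast
  define S where "S = {c. Inr c \<in> set1_fm \<psi>}"
  have "finite S"
    using finite_vimageI[OF finite_set1_fm[of \<psi>], of Inr] by (simp add: S_def vimage_def)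
  then have S: "countable S" by (rule countable_finite)
  have SA: "S \<subseteq> A"
    using \<psi> wf_fm_constants[of L A \<psi>] by (auto simp: S_def form_def)
  define k where "k = to_nat_on S"
  define h where "h w = (if even w then Inl (w div 2) else Inr (from_nat_into S (w div 2)))" for w
  let ?\<phi> = "abstract_fm k \<psi>"
  have k: "from_nat_into S (k c) = c" if "Inr c \<in> set1_fm \<psi>" for c
    using that S by (simp add: k_def S_def)
  have "wf_fm L ?\<phi>"
    using \<psi> by (auto simp: form_def intro: wf_abstract_fm)
  moreover have "h w \<in> {..<n} <+> A" if "w \<in> fv ?\<phi>" for w
    using fv_abstract_fm[OF that]
  proof (elim disjE bexE exE conjE)
    fix v assume "v \<in> fv \<psi>" "w = 2 * v"
    then show ?thesis using \<psi> by (auto simp: h_def form_def)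
  next
    fix c assume "Inr c \<in> set1_fm \<psi>" "w = 2 * k c + 1"
    then show ?thesis using SA k by (auto simp: h_def S_def)
  qed
  moreover have "Q a \<longleftrightarrow> sat U (case_sum (nth a) id \<circ> h) ?\<phi>" if "a \<in> tuples (univ U) n" for a
  proof -
    have "sat U (case_sum (nth a) id \<circ> h) ?\<phi> \<longleftrightarrow>
        sat (struct_with U) (\<lambda>v. (case_sum (nth a) id \<circ> h) (2 * v)) \<psi>"
      by (rule sat_abstract_fm) (simp add: h_def k)
    also have "\<dots> \<longleftrightarrow> holds (struct_with U) a \<psi>"
      unfolding holds_def by (simp add: h_def)
    finally show ?thesis using Q that by simp
  qed
  ultimately show ?R by blast
next
  assume ?R
  then obtain \<phi> h where \<phi>: "wf_fm L \<phi>" and h: "\<And>v. v \<in> fv \<phi> \<Longrightarrow> h v \<in> {..<n} <+> A"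
    and Q: "\<And>a. a \<in> tuples (univ U) n \<Longrightarrow> Q a \<longleftrightarrow> sat U (case_sum (nth a) id \<circ> h) \<phi>"
    by blast
  define s where "s w = (if n \<le> w then case_sum (\<lambda>_. None) Some (h (w - n)) else None)" for w
  define f where "f v = case_sum id (\<lambda>_. n + v) (h v)" for v
  let ?\<psi> = "inst_fm s (rename f \<phi>)"
  have s: "s (f v) = case_sum (\<lambda>_. None) Some (h v)" if "v \<in> fv \<phi>" for v
    using h[OF that] by (auto simp: s_def f_def)
  have fv: "w \<in> f ` fv \<phi>" if "w \<in> fv (rename f \<phi>)" for w
    using that fv_rename[of f \<phi>] by blast
  have "wf_fm (lang_with L A) ?\<psi>"
  proof (rule wf_inst_fm)
    show "wf_fm L (rename f \<phi>)" using \<phi> by (rule wf_rename)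
    fix w c assume w: "w \<in> fv (rename f \<phi>)" "s w = Some c"
    then obtain v where v: "v \<in> fv \<phi>" "w = f v" using fv by blast
    then show "c \<in> A" using s[OF v(1)] h[OF v(1)] w(2) by (auto split: sum.splits)
  qed
  moreover have "fv ?\<psi> \<subseteq> {..<n}"
  proof
    fix w assume "w \<in> fv ?\<psi>"
    then have w: "w \<in> fv (rename f \<phi>)" "s w = None" by (auto simp: fv_inst_fm)
    then obtain v where v: "v \<in> fv \<phi>" "w = f v" using fv by blast
    then show "w \<in> {..<n}"
      using s[OF v(1)] h[OF v(1)] w(2) by (auto simp: f_def split: sum.splits)
  qed
  moreover have "Q a \<longleftrightarrow> holds (struct_with U) a ?\<psi>" if "a \<in> tuples (univ U) n" for a
  proof -
    have "holds (struct_with U) a ?\<psi> \<longleftrightarrow>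
        sat U ((\<lambda>v. case s v of None \<Rightarrow> a ! v | Some c \<Rightarrow> c) \<circ> f) \<phi>"
      unfolding holds_def sat_inst_fm sat_rename ..
    also have "\<dots> \<longleftrightarrow> sat U (case_sum (nth a) id \<circ> h) \<phi>"
    proof (rule sat_cong)
      fix v assume v: "v \<in> fv \<phi>"
      show "((\<lambda>v. case s v of None \<Rightarrow> a ! v | Some c \<Rightarrow> c) \<circ> f) v = (case_sum (nth a) id \<circ> h) v"
        using s[OF v] by (auto simp: f_def split: sum.splits)
    qed
    finally show ?thesis using Q that by simp
  qed
  ultimately show "definable A n Q"
    unfolding definable_def form_def by blast
qed

text \<open>Each argument of \<open>R\<close> may be a coordinate of the new tuple or a parameter. Permuting, repeating and
  fixing arguments are all instances.\<close>

lemma definable_subst: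
  assumes R: "definable A m R" and "A \<subseteq> B"
    and t: "\<And>i. i < m \<Longrightarrow> t i \<in> {..<n} <+> (B \<inter> univ U)"
  shows "definable B n (\<lambda>a. R (map (case_sum (nth a) id \<circ> t) [0..<m]))"
proof -
  obtain \<phi> h where \<phi>: "wf_fm L \<phi>" and h: "\<And>v. v \<in> fv \<phi> \<Longrightarrow> h v \<in> {..<m} <+> A"
    and R: "\<And>a. a \<in> tuples (univ U) m \<Longrightarrow> R a \<longleftrightarrow> sat U (case_sum (nth a) id \<circ> h) \<phi>"
    using R unfolding definable_iff by blast
  define h' where "h' v = case_sum t Inr (h v)" for v
  have "h' v \<in> {..<n} <+> B" if "v \<in> fv \<phi>" for v
    using h[OF that] t \<open>A \<subseteq> B\<close> by (fastforce simp: h'_def)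
  moreover have "R (map (case_sum (nth a) id \<circ> t) [0..<m]) \<longleftrightarrow> sat U (case_sum (nth a) id \<circ> h') \<phi>"
    if a: "a \<in> tuples (univ U) n" for a
  proof -
    let ?b = "map (case_sum (nth a) id \<circ> t) [0..<m]"
    have "case_sum (nth a) id (t i) \<in> univ U" if "i < m" for i
      using t[OF that] a nth_mem[of _ a] by (auto simp: tuples_def)
    then have "?b \<in> tuples (univ U) m" by (auto simp: tuples_def)
    then have "R ?b \<longleftrightarrow> sat U (case_sum (nth ?b) id \<circ> h) \<phi>" by (rule R)
    also have "\<dots> \<longleftrightarrow> sat U (case_sum (nth a) id \<circ> h') \<phi>"
      using h by (intro sat_cong) (fastforce simp: h'_def)
    finally show ?thesis .
  qed
  ultimately show ?thesis
    unfolding definable_iff using \<phi> by blast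
qed

lemma definable_swap:
  assumes "definable A (m + n) R"
  shows "definable A (n + m) (\<lambda>a. R (drop n a @ take n a))"
proof -
  define t where "t i = (Inl (if i < m then n + i else i - m) :: nat + 'a)" for i
  have "definable A (n + m) (\<lambda>a. R (map (case_sum (nth a) id \<circ> t) [0..<m + n]))"
    by (rule definable_subst[OF assms]) (auto simp: t_def)
  moreover have "map (case_sum (nth a) id \<circ> t) [0..<m + n] = drop n a @ take n a"
    if "a \<in> tuples (univ U) (n + m)" for a
    using tuplesD(1)[OF that] by (intro nth_equalityI) (auto simp: t_def nth_append)
  ultimately show ?thesis
    by (subst definable_cong[where Q' = "\<lambda>a. R (map (case_sum (nth a) id \<circ> t) [0..<m + n])"]) simp_all
qed

lemma definable_append_left:
  assumes "definable A (m + n) R" and b: "b \<in> tuples (univ U) m" and "A \<union> set b \<subseteq> B"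
  shows "definable B n (\<lambda>a. R (b @ a))"
proof -
  define t where "t i = (if i < m then Inr (b ! i) else Inl (i - m))" for i
  have "definable B n (\<lambda>a. R (map (case_sum (nth a) id \<circ> t) [0..<m + n]))"
    using assms(2,3) nth_mem[of _ b]
    by (intro definable_subst[OF assms(1)]) (auto simp: t_def tuples_def)
  moreover have "map (case_sum (nth a) id \<circ> t) [0..<m + n] = b @ a"
    if "a \<in> tuples (univ U) n" for a
    using tuplesD(1)[OF that] tuplesD(1)[OF b]
    by (intro nth_equalityI) (auto simp: t_def nth_append)
  ultimately show ?thesis
    by (subst definable_cong[where Q' = "\<lambda>a. R (map (case_sum (nth a) id \<circ> t) [0..<m + n])"]) simp_all
qed

lemma definable_append_right:
  assumes R: "definable A (n + m) R" and b: "b \<in> tuples (univ U) m" and B: "A \<union> set b \<subseteq> B"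
  shows "definable B n (\<lambda>a. R (a @ b))"
proof -
  have "definable B n (\<lambda>a. R (drop m (b @ a) @ take m (b @ a)))"
    by (rule definable_append_left[OF definable_swap[OF R] b B])
  then show ?thesis using tuplesD(1)[OF b] by simp
qed

lemma definable_parameters:
  assumes "definable (A \<union> set b) n Q" and b: "b \<in> tuples (univ U) m"
  obtains R where "definable A (m + n) R" "\<And>a. a \<in> tuples (univ U) n \<Longrightarrow> Q a \<longleftrightarrow> R (b @ a)"
proof -
  obtain \<phi> h where \<phi>: "wf_fm L \<phi>" and h: "\<And>v. v \<in> fv \<phi> \<Longrightarrow> h v \<in> {..<n} <+> (A \<union> set b)"
    and Q: "\<And>a. a \<in> tuples (univ U) n \<Longrightarrow> Q a \<longleftrightarrow> sat U (case_sum (nth a) id \<circ> h) \<phi>"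
    using assms unfolding definable_iff by blast
  define idx where "idx c = (SOME i. i < m \<and> b ! i = c)" for c
  have idx: "idx c < m \<and> b ! idx c = c" if "c \<in> set b" for c
    unfolding idx_def by (rule someI_ex) (use that b in \<open>auto simp: tuples_def in_set_conv_nth\<close>)
  define h' where
    "h' v = (case h v of Inl j \<Rightarrow> Inl (m + j) | Inr c \<Rightarrow> if c \<in> A then Inr c else Inl (idx c))" for v
  define R where "R a \<longleftrightarrow> sat U (case_sum (nth a) id \<circ> h') \<phi>" for a
  show thesis
  proof
    have "h' v \<in> {..<m + n} <+> A" if "v \<in> fv \<phi>" for v
      using h[OF that] idx by (fastforce simp: h'_def)
    then show "definable A (m + n) R"
      unfolding definable_iff R_def using \<phi> by blast
    fix a assume a: "a \<in> tuples (univ U) n"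
    have "R (b @ a) \<longleftrightarrow> sat U (case_sum (nth a) id \<circ> h) \<phi>"
      unfolding R_def
    proof (rule sat_cong)
      fix v assume "v \<in> fv \<phi>"
      then show "(case_sum (nth (b @ a)) id \<circ> h') v = (case_sum (nth a) id \<circ> h) v"
        using h[of v] idx tuplesD(1)[OF b] by (auto simp: h'_def nth_append split: sum.splits)
    qed
    then show "Q a \<longleftrightarrow> R (b @ a)" using Q[OF a] by simp
  qed
qed

lemma definable_empty:
  assumes "definable {} n Q"
  obtains \<phi> where "\<phi> \<in> form L n" "\<And>a. a \<in> tuples (univ U) n \<Longrightarrow> Q a \<longleftrightarrow> holds U a \<phi>"
proof -
  obtain \<phi> h where \<phi>: "wf_fm L \<phi>" and h: "\<And>v. v \<in> fv \<phi> \<Longrightarrow> h v \<in> {..<n} <+> {}"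
    and Q: "\<And>a. a \<in> tuples (univ U) n \<Longrightarrow> Q a \<longleftrightarrow> sat U (case_sum (nth a) id \<circ> h) \<phi>"
    using assms unfolding definable_iff by blast
  define f where "f v = projl (h v)" for v
  have f: "f v < n" "h v = Inl (f v)" if "v \<in> fv \<phi>" for v
    using h[OF that] by (auto simp: f_def)
  show thesis
  proof
    show "rename f \<phi> \<in> form L n"
      using wf_rename[OF \<phi>, of f] fv_rename[of f \<phi>] f(1) by (auto simp: form_def)
    fix a assume a: "a \<in> tuples (univ U) n"
    have "holds U a (rename f \<phi>) \<longleftrightarrow> sat U (case_sum (nth a) id \<circ> h) \<phi>"
      unfolding holds_def sat_rename using f(2) by (intro sat_cong) simp
    then show "Q a \<longleftrightarrow> holds U a (rename f \<phi>)" using Q[OF a] by simp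
  qed
qed

lemma definable_form:
  assumes \<phi>: "\<phi> \<in> form L n"
  shows "definable A n (\<lambda>a. holds U a \<phi>)"
proof -
  have "\<forall>v \<in> fv \<phi>. Inl v \<in> {..<n} <+> A" using \<phi> by (auto simp: form_def)
  moreover have "holds U a \<phi> \<longleftrightarrow> sat U (case_sum (nth a) id \<circ> Inl) \<phi>" for a
    unfolding holds_def by (simp add: comp_def)
  ultimately show ?thesis
    unfolding definable_iff using \<phi> by (intro exI[of _ \<phi>] exI[of _ Inl]) (auto simp: form_def)
qed

lemma definable_automorphism:
  assumes g: "automorphism L U g" and Q: "definable {} n Q" and a: "a \<in> tuples (univ U) n"
  shows "Q (map g a) \<longleftrightarrow> Q a"
proof -
  obtain \<phi> where \<phi>: "\<phi> \<in> form L n" and Q: "\<And>a. a \<in> tuples (univ U) n \<Longrightarrow> Q a \<longleftrightarrow> holds U a \<phi>"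
    using definable_empty[OF Q] by blast
  obtain u where u: "u \<in> univ U" using struct by (auto simp: is_struct_def)
  define e where "e i = (if i < n then a ! i else u)" for i
  have e: "e i \<in> univ U" for i
    using a u nth_mem[of i a] by (auto simp: e_def tuples_def)
  have ga: "map g a \<in> tuples (univ U) n"
    using g a by (auto simp: automorphism_def bij_betw_def tuples_def)
  have "holds U (map g a) \<phi> \<longleftrightarrow> sat U (g \<circ> e) \<phi>"
    using tuplesD(1)[OF a] by (intro holds_cong[OF \<phi>, symmetric]) (simp add: e_def)
  also have "\<dots> \<longleftrightarrow> sat U e \<phi>"
    using \<phi> by (intro sat_automorphism[OF g struct e]) (simp add: form_def)
  also have "\<dots> \<longleftrightarrow> holds U a \<phi>"
    by (intro holds_cong[OF \<phi>]) (simp add: e_def)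
  finally show ?thesis using Q[OF a] Q[OF ga] by simp
qed

text \<open>The Tarski-Vaught property for whole tuples: the existential closure of the formula is transferred to
  \<open>M\<close>, and the solution found there is transferred back.\<close>

lemma definable_elem_substruct:
  assumes M: "elem_substruct L M U" and Q: "definable (univ M) n Q"
    and ex: "\<exists>a \<in> tuples (univ U) n. Q a"
  shows "\<exists>a \<in> tuples (univ M) n. Q a"
proof -
  have sub: "univ M \<subseteq> univ U" and ne: "univ M \<noteq> {}"
    and elem: "\<And>k \<phi> a. \<phi> \<in> form L k \<Longrightarrow> a \<in> tuples (univ M) k \<Longrightarrow> holds M a \<phi> \<longleftrightarrow> holds U a \<phi>"
    using M by (auto simp: elem_substruct_def substruct_def is_struct_def)
  obtain F where F: "finite F" "F \<subseteq> univ M" "definable F n Q"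
    using definable_finite[OF Q] by blast
  obtain b where b: "set b = F" using finite_list[OF F(1)] by blast
  define m where "m = length b"
  have bM: "b \<in> tuples (univ M) m" using b F by (auto simp: tuples_def m_def)
  then have bU: "b \<in> tuples (univ U) m" using tuples_mono[OF sub] by blast
  have "definable ({} \<union> set b) n Q" using F(3) b by simp
  then obtain R where R: "definable {} (m + n) R" "\<And>a. a \<in> tuples (univ U) n \<Longrightarrow> Q a \<longleftrightarrow> R (b @ a)"
    using definable_parameters bU by metis
  obtain \<phi> where \<phi>: "\<phi> \<in> form L (m + n)"
    and R\<phi>: "\<And>a. a \<in> tuples (univ U) (m + n) \<Longrightarrow> R a \<longleftrightarrow> holds U a \<phi>"
    using definable_empty[OF R(1)] by blast
  let ?\<theta> = "foldr Ex [m..<m + n] \<phi>"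
  have \<theta>: "?\<theta> \<in> form L m"
    using \<phi> by (auto simp: form_def fv_foldr_Ex wf_foldr_Ex)
  have split: "holds N b ?\<theta> \<longleftrightarrow> (\<exists>a \<in> tuples (univ N) n. holds N (b @ a) \<phi>)" for N :: "('f, 'r, 'a) struct"
  proof -
    have "sat N (\<lambda>v. if m \<le> v \<and> v < m + n then a ! (v - m) else b ! v) \<phi> \<longleftrightarrow> holds N (b @ a) \<phi>" for a
      by (intro holds_cong[OF \<phi>]) (auto simp: nth_append m_def)
    then show ?thesis unfolding holds_def[of N b] sat_foldr_Ex by simp
  qed
  have "holds U b ?\<theta>"
    using ex R(2) R\<phi> tuples_append[OF bU] unfolding split by blast
  then have "holds M b ?\<theta>" using elem[OF \<theta> bM] by simp
  then obtain a where a: "a \<in> tuples (univ M) n" "holds M (b @ a) \<phi>"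
    unfolding split by blast
  have aU: "a \<in> tuples (univ U) n" using a(1) tuples_mono[OF sub] by blast
  have "holds U (b @ a) \<phi>"
    using elem[OF \<phi> tuples_append[OF bM a(1)]] a(2) by simp
  then have "Q a" using R(2)[OF aU] R\<phi>[OF tuples_append[OF bU aU]] by simp
  then show ?thesis using a(1) by blast
qed

end

lemma form_directed_union:
  assumes "\<phi> \<in> form (lang_with L (A \<union> (\<Union>k. B k))) n" and "mono B"
  shows "\<exists>k::nat. \<phi> \<in> form (lang_with L (A \<union> B k)) n"
proof -
  obtain F where F: "finite F" "F \<subseteq> A \<union> (\<Union>k. B k)" "\<phi> \<in> form (lang_with L F) n"
    using form_finite_constants[OF assms(1)] by blast
  have "\<exists>k. G \<subseteq> A \<union> B k" if "finite G" "G \<subseteq> A \<union> (\<Union>k. B k)" for G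
    using that
  proof (induction G)
    case (insert c G)
    then obtain k k' where "G \<subseteq> A \<union> B k" "c \<in> A \<union> B k'" by blast
    moreover have "B k \<subseteq> B (max k k')" "B k' \<subseteq> B (max k k')"
      using monoD[OF \<open>mono B\<close>, of k "max k k'"] monoD[OF \<open>mono B\<close>, of k' "max k k'"] by simp_all
    ultimately show ?case by (intro exI[of _ "max k k'"]) blast
  qed simp
  then obtain k where "F \<subseteq> A \<union> B k" using F by blast
  then show ?thesis using form_mono F(3) by blast
qed

lemma holds_inst:
  assumes \<phi>: "\<phi> \<in> form L (n + m)" and "length a = n" "length b = m"
  shows "holds (struct_with U) a (inst n b \<phi>) \<longleftrightarrow> holds U (a @ b) \<phi>"
  unfolding inst_def holds_def[of "struct_with U"] sat_inst_fm
  using assms(2,3) by (intro holds_cong[OF \<phi>]) (auto simp: nth_append)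

lemma inst_form:
  assumes \<phi>: "\<phi> \<in> form L (n + m)" and b: "b \<in> tuples A m"
  shows "inst n b \<phi> \<in> form (lang_with L A) n"
  unfolding inst_def form_def mem_Collect_eq
proof
  let ?s = "\<lambda>v. if n \<le> v \<and> v < n + length b then Some (b ! (v - n)) else None"
  show "wf_fm (lang_with L A) (inst_fm ?s \<phi>)"
  proof (rule wf_inst_fm)
    fix v c assume "?s v = Some c"
    then have "c \<in> set b" by (auto split: if_splits)
    then show "c \<in> A" using b by (auto simp: tuples_def)
  qed (use \<phi> in \<open>simp add: form_def\<close>)
  show "fv (inst_fm ?s \<phi>) \<subseteq> {..<n}"
    using \<phi> b by (auto simp: fv_inst_fm form_def tuples_def subset_eq split: if_splits)
qed

definition initial :: "(nat \<Rightarrow> 'a list) \<Rightarrow> nat \<Rightarrow> 'a list" where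
  "initial a k = concat (map a [0..<k])"

lemma initial_0 [simp]: "initial a 0 = []"
  by (simp add: initial_def)

lemma initial_Suc: "initial a (Suc k) = initial a k @ a k"
  by (simp add: initial_def)

lemma initial_cong: "(\<And>i. i < k \<Longrightarrow> a i = b i) \<Longrightarrow> initial a k = initial b k"
  unfolding initial_def by (intro arg_cong[where f = concat] map_cong) auto

lemma set_initial: "set (initial a k) = (\<Union>i<k. set (a i))"
  by (induction k) (auto simp: initial_Suc lessThan_Suc)

lemma initial_tuples: "(\<And>i. a i \<in> tuples A n) \<Longrightarrow> initial a k \<in> tuples A (k * n)"
  by (induction k) (auto simp: tuples_def initial_Suc)

lemma mono_set_initial: "mono (\<lambda>k. set (initial a k))"
  by (rule incseq_SucI) (auto simp: initial_Suc)

lemma initial_add: "initial a (k + l) = initial a k @ initial (\<lambda>i. a (k + i)) l"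
  by (induction l) (simp_all add: initial_Suc)

context fo_structure
begin

lemma definable_directed_union:
  assumes "definable (A \<union> (\<Union>k. B k)) n Q" and "mono B"
  shows "\<exists>k::nat. definable (A \<union> B k) n Q"
  using assms form_directed_union unfolding definable_def by metis

section \<open>Types as ultrafilters of definable predicates\<close>

text \<open>Since membership in a complete type only depends on the predicate that a formula defines, \<open>p\<close> acts as an
  ultrafilter on the algebra of definable predicates.\<close>

definition in_type :: "nat \<Rightarrow> ('f + 'a, 'r) fm set \<Rightarrow> ('a list \<Rightarrow> bool) \<Rightarrow> bool" where
  "in_type n p Q \<longleftrightarrow> (\<exists>\<psi> \<in> p. \<forall>a \<in> tuples (univ U) n. Q a \<longleftrightarrow> holds (struct_with U) a \<psi>)"

definition fin_sat :: "'a list set \<Rightarrow> ('f + 'a, 'r) fm set \<Rightarrow> bool" where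
  "fin_sat X p \<longleftrightarrow> (\<forall>q. finite q \<and> q \<subseteq> p \<longrightarrow> (\<exists>a \<in> X. \<forall>\<phi> \<in> q. holds (struct_with U) a \<phi>))"

abbreviation types :: "nat \<Rightarrow> ('f + 'a, 'r) fm set set" where
  "types n \<equiv> type_space L U (univ U) n"

lemma types_iff:
  "p \<in> types n \<longleftrightarrow> p \<subseteq> form (lang_with L (univ U)) n \<and> fin_sat (tuples (univ U) n) p \<and>
     (\<forall>\<phi> \<in> form (lang_with L (univ U)) n. \<phi> \<in> p \<or> Neg \<phi> \<in> p)"
  by (simp only: type_space_def fin_sat_def mem_Collect_eq)

lemma types_cases:
  "p \<in> types n \<Longrightarrow> \<phi> \<in> form (lang_with L (univ U)) n \<Longrightarrow> \<phi> \<in> p \<or> Neg \<phi> \<in> p"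
  by (simp add: types_iff)

lemma types_fin_sat: "p \<in> types n \<Longrightarrow> fin_sat (tuples (univ U) n) p"
  by (simp add: types_iff)

lemma in_type_cong:
  "(\<And>a. a \<in> tuples (univ U) n \<Longrightarrow> Q a \<longleftrightarrow> Q' a) \<Longrightarrow> in_type n p Q \<longleftrightarrow> in_type n p Q'"
  unfolding in_type_def by simp

lemma in_type_witness:
  assumes p: "fin_sat X p" and X: "X \<subseteq> tuples (univ U) n"
    and "finite I" and Q: "\<And>i. i \<in> I \<Longrightarrow> in_type n p (Q i)"
  shows "\<exists>a \<in> X. \<forall>i \<in> I. Q i a"
proof -
  obtain \<psi> where \<psi>: "\<And>i. i \<in> I \<Longrightarrow> \<psi> i \<in> p"
    "\<And>i a. i \<in> I \<Longrightarrow> a \<in> tuples (univ U) n \<Longrightarrow> Q i a \<longleftrightarrow> holds (struct_with U) a (\<psi> i)"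
    using Q unfolding in_type_def by metis
  have "finite (\<psi> ` I)" "\<psi> ` I \<subseteq> p" using \<open>finite I\<close> \<psi>(1) by auto
  then obtain a where "a \<in> X" "\<forall>\<phi> \<in> \<psi> ` I. holds (struct_with U) a \<phi>"
    using p unfolding fin_sat_def by blast
  then show ?thesis using \<psi>(2) X by blast
qed

lemma in_type_witness1:
  assumes "fin_sat X p" "X \<subseteq> tuples (univ U) n" "in_type n p Q"
  shows "\<exists>a \<in> X. Q a"
  using in_type_witness[OF assms(1,2), of "{()}" "\<lambda>_. Q"] assms(3) by simp

lemma in_type_witness2:
  assumes "fin_sat X p" "X \<subseteq> tuples (univ U) n" "in_type n p Q" "in_type n p R"
  shows "\<exists>a \<in> X. Q a \<and> R a"
proof -
  have "\<exists>a \<in> X. \<forall>b \<in> {True, False}. (if b then Q else R) a"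
    by (rule in_type_witness[OF assms(1,2)]) (use assms(3,4) in auto)
  then show ?thesis by auto
qed

lemma in_type_not:
  assumes p: "p \<in> types n" and Q: "definable (univ U) n Q"
  shows "in_type n p (\<lambda>a. \<not> Q a) \<longleftrightarrow> \<not> in_type n p Q"
proof -
  obtain \<psi> where \<psi>: "\<psi> \<in> form (lang_with L (univ U)) n"
    "\<forall>a \<in> tuples (univ U) n. Q a \<longleftrightarrow> holds (struct_with U) a \<psi>"
    using Q unfolding definable_def by blast
  have "\<forall>a \<in> tuples (univ U) n. \<not> Q a \<longleftrightarrow> holds (struct_with U) a (Neg \<psi>)"
    using \<psi>(2) by (simp add: holds_def)
  moreover have "\<psi> \<in> p \<or> Neg \<psi> \<in> p" using types_cases[OF p \<psi>(1)] .
  ultimately have "in_type n p Q \<or> in_type n p (\<lambda>a. \<not> Q a)"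
    using \<psi>(2) unfolding in_type_def by blast
  moreover have "\<not> (in_type n p Q \<and> in_type n p (\<lambda>a. \<not> Q a))"
    using in_type_witness2[OF types_fin_sat[OF p], of n Q "\<lambda>a. \<not> Q a"] by blast
  ultimately show ?thesis by blast
qed

lemma in_type_holds:
  assumes p: "p \<in> types n" and \<psi>: "\<psi> \<in> form (lang_with L (univ U)) n"
  shows "in_type n p (\<lambda>a. holds (struct_with U) a \<psi>) \<longleftrightarrow> \<psi> \<in> p"
proof
  assume in_p: "in_type n p (\<lambda>a. holds (struct_with U) a \<psi>)"
  show "\<psi> \<in> p"
  proof (rule ccontr)
    assume "\<psi> \<notin> p"
    then have "Neg \<psi> \<in> p" using types_cases[OF p \<psi>] by blast
    then have "in_type n p (\<lambda>a. \<not> holds (struct_with U) a \<psi>)"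
      unfolding in_type_def by (intro bexI[of _ "Neg \<psi>"]) (auto simp: holds_def)
    then show False using in_p in_type_not[OF p definable_holds[OF \<psi>]] by blast
  qed
next
  assume "\<psi> \<in> p"
  then show "in_type n p (\<lambda>a. holds (struct_with U) a \<psi>)"
    unfolding in_type_def by blast
qed

lemma types_not_both:
  assumes q: "q \<in> types n" and \<theta>: "\<theta> \<in> q"
  shows "Neg \<theta> \<notin> q"
proof
  assume "Neg \<theta> \<in> q"
  then have "finite {\<theta>, Neg \<theta>} \<and> {\<theta>, Neg \<theta>} \<subseteq> q" using \<theta> by simp
  then obtain a where "\<forall>\<phi> \<in> {\<theta>, Neg \<theta>}. holds (struct_with U) a \<phi>"
    using types_fin_sat[OF q] unfolding fin_sat_def by blast
  then show False by (simp add: holds_def)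
qed

lemma in_type_finite_all:
  assumes p: "p \<in> types n" and q: "finite q" "q \<subseteq> p"
  shows "in_type n p (\<lambda>a. \<forall>\<phi> \<in> q. holds (struct_with U) a \<phi>)"
proof (rule ccontr)
  let ?Q = "\<lambda>a. \<forall>\<phi> \<in> q. holds (struct_with U) a \<phi>"
  have form: "\<phi> \<in> form (lang_with L (univ U)) n" if "\<phi> \<in> q" for \<phi>
    using that q p by (auto simp: types_iff)
  then have "definable (univ U) n ?Q"
    by (intro definable_finite_all q definable_holds)
  moreover assume "\<not> in_type n p ?Q"
  ultimately have "in_type n p (\<lambda>a. \<not> ?Q a)" using in_type_not[OF p] by blast
  then obtain \<theta> where \<theta>: "\<theta> \<in> p" "\<forall>a \<in> tuples (univ U) n. \<not> ?Q a \<longleftrightarrow> holds (struct_with U) a \<theta>"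
    unfolding in_type_def by blast
  have "finite (insert \<theta> q)" "insert \<theta> q \<subseteq> p" using q \<theta>(1) by auto
  then obtain a where "a \<in> tuples (univ U) n" "\<forall>\<phi> \<in> insert \<theta> q. holds (struct_with U) a \<phi>"
    using types_fin_sat[OF p] unfolding fin_sat_def by blast
  then show False using \<theta>(2) by blast
qed

definition realizes_over :: "nat \<Rightarrow> ('f + 'a, 'r) fm set \<Rightarrow> 'a set \<Rightarrow> 'a list \<Rightarrow> bool" where
  "realizes_over n p A a \<longleftrightarrow> a \<in> tuples (univ U) n \<and> realizes U a (type_restrict L n p A)"

lemma realizes_over_mono: "A \<subseteq> B \<Longrightarrow> realizes_over n p B a \<Longrightarrow> realizes_over n p A a"
  using form_mono unfolding realizes_over_def realizes_def type_restrict_def by blast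

lemma realizes_over_iff:
  assumes p: "p \<in> types n" and A: "A \<subseteq> univ U"
  shows "realizes_over n p A a \<longleftrightarrow>
    a \<in> tuples (univ U) n \<and> (\<forall>Q. definable A n Q \<longrightarrow> (Q a \<longleftrightarrow> in_type n p Q))"
    (is "_ \<longleftrightarrow> ?R")
proof
  assume a: "realizes_over n p A a"
  have "Q a" if Q: "definable A n Q" and in_p: "in_type n p Q" for Q
  proof -
    obtain \<psi> where \<psi>: "\<psi> \<in> form (lang_with L A) n"
      "\<forall>a \<in> tuples (univ U) n. Q a \<longleftrightarrow> holds (struct_with U) a \<psi>"
      using Q unfolding definable_def by blast
    have "in_type n p Q \<longleftrightarrow> in_type n p (\<lambda>a. holds (struct_with U) a \<psi>)"
      by (rule in_type_cong) (use \<psi>(2) in blast)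
    with in_p have "\<psi> \<in> p"
      using in_type_holds[OF p] \<psi>(1) form_mono[OF A] by blast
    then show "Q a"
      using a \<psi> unfolding realizes_over_def realizes_def type_restrict_def by blast
  qed
  note Q = this
  have "Q a \<longleftrightarrow> in_type n p Q" if "definable A n Q" for Q
    using Q[OF that] Q[OF definable_not[OF that]] in_type_not[OF p definable_mono[OF A that]]
    by blast
  then show ?R using a unfolding realizes_over_def by blast
next
  assume R: ?R
  have "holds (struct_with U) a \<psi>" if "\<psi> \<in> p" "\<psi> \<in> form (lang_with L A) n" for \<psi>
  proof -
    have "in_type n p (\<lambda>a. holds (struct_with U) a \<psi>)"
      using that form_mono[OF A] by (subst in_type_holds[OF p]) blast+
    then show ?thesis using R definable_holds[OF that(2)] by blast
  qed
  then show "realizes_over n p A a"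
    using R unfolding realizes_over_def realizes_def type_restrict_def by blast
qed

lemma realizes_overD:
  assumes "realizes_over n p A a" "p \<in> types n" "A \<subseteq> univ U" "definable A n Q"
  shows "Q a \<longleftrightarrow> in_type n p Q"
  using assms realizes_over_iff by blast

lemma realizes_overI:
  assumes p: "p \<in> types n" and A: "A \<subseteq> univ U" and a: "a \<in> tuples (univ U) n"
    and Q: "\<And>Q. definable A n Q \<Longrightarrow> in_type n p Q \<Longrightarrow> Q a"
  shows "realizes_over n p A a"
proof -
  have "Q a \<longleftrightarrow> in_type n p Q" if "definable A n Q" for Q
    using Q[OF that] Q[OF definable_not[OF that]] in_type_not[OF p definable_mono[OF A that]] by blast
  then show ?thesis unfolding realizes_over_iff[OF p A] using a by blast
qed

text \<open>The global type is obtained as a maximal set of formulas finitely satisfiable in \<open>X\<close>; keeping \<open>X\<close> in the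
  statement provides coheirs (\<open>X\<close> the tuples of \<open>M\<close>) as well as accumulation points of sequences
  (\<open>X\<close> the range).\<close>

lemma extend_to_type:
  assumes X: "X \<subseteq> tuples (univ U) n" and S: "S \<subseteq> form (lang_with L (univ U)) n" "fin_sat X S"
  shows "\<exists>q \<in> types n. S \<subseteq> q \<and> fin_sat X q"
proof -
  let ?F = "form (lang_with L (univ U)) n"
  let ?A = "{q. S \<subseteq> q \<and> q \<subseteq> ?F \<and> fin_sat X q}"
  have "\<exists>q \<in> ?A. \<forall>q' \<in> ?A. q \<subseteq> q' \<longrightarrow> q' = q"
  proof (rule subset_Zorn_nonempty)
    show "?A \<noteq> {}" using S by blast
    fix C assume C: "C \<noteq> {}" "subset.chain ?A C"
    then have sub: "C \<subseteq> ?A" by (simp add: subset_chain_def)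
    have "fin_sat X (\<Union>C)"
      unfolding fin_sat_def
    proof (intro allI impI, elim conjE)
      fix q assume q: "finite q" "q \<subseteq> \<Union>C"
      then obtain c where "c \<in> C" "q \<subseteq> c"
        by (rule finite_subset_Union_chain[OF _ _ C])
      then show "\<exists>a \<in> X. \<forall>\<phi> \<in> q. holds (struct_with U) a \<phi>"
        using sub q(1) unfolding fin_sat_def by blast
    qed
    then show "\<Union>C \<in> ?A" using sub C(1) by blast
  qed
  then obtain q where "q \<in> ?A" and max: "\<forall>q' \<in> ?A. q \<subseteq> q' \<longrightarrow> q' = q" ..
  then have q: "S \<subseteq> q" "q \<subseteq> ?F" "fin_sat X q" by simp_all
  have bad: "\<exists>r. finite r \<and> r \<subseteq> q \<and> (\<forall>a \<in> X. (\<forall>\<phi> \<in> r. holds (struct_with U) a \<phi>) \<longrightarrow> \<not> holds (struct_with U) a \<psi>)"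
    if \<psi>: "\<psi> \<in> ?F" "\<psi> \<notin> q" for \<psi>
  proof -
    have "\<not> fin_sat X (insert \<psi> q)"
    proof
      assume "fin_sat X (insert \<psi> q)"
      then have "insert \<psi> q \<in> ?A" using q(1,2) \<psi>(1) by auto
      with max have "q \<subseteq> insert \<psi> q \<longrightarrow> insert \<psi> q = q" by (rule bspec)
      then have "insert \<psi> q = q" by blast
      then show False using \<psi>(2) by blast
    qed
    then obtain r where r: "finite r" "r \<subseteq> insert \<psi> q" "\<not> (\<exists>a \<in> X. \<forall>\<phi> \<in> r. holds (struct_with U) a \<phi>)"
      unfolding fin_sat_def by blast
    then show ?thesis by (intro exI[of _ "r - {\<psi>}"]) blast
  qed
  have "\<psi> \<in> q \<or> Neg \<psi> \<in> q" if \<psi>: "\<psi> \<in> ?F" for \<psi>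
  proof (rule ccontr)
    assume "\<not> ?thesis"
    moreover have "Neg \<psi> \<in> ?F" using \<psi> by (simp add: form_def)
    ultimately obtain r r' where r: "finite r" "r \<subseteq> q" "finite r'" "r' \<subseteq> q"
      "\<And>a. a \<in> X \<Longrightarrow> \<forall>\<phi> \<in> r. holds (struct_with U) a \<phi> \<Longrightarrow> \<not> holds (struct_with U) a \<psi>"
      "\<And>a. a \<in> X \<Longrightarrow> \<forall>\<phi> \<in> r'. holds (struct_with U) a \<phi> \<Longrightarrow> \<not> holds (struct_with U) a (Neg \<psi>)"
      using bad[of \<psi>] bad[of "Neg \<psi>"] \<psi> by metis
    obtain a where "a \<in> X" "\<forall>\<phi> \<in> r \<union> r'. holds (struct_with U) a \<phi>"
      using q(3) r(1-4) unfolding fin_sat_def by (metis finite_UnI le_sup_iff)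
    then show False using r(5,6)[of a] by (auto simp: holds_def)
  qed
  moreover have "fin_sat (tuples (univ U) n) q"
    using q(3) X unfolding fin_sat_def by blast
  ultimately have "q \<in> types n" using q(2) by (simp add: types_iff)
  then show ?thesis using q(1,3) by blast
qed

section \<open>Invariance and Morley sequences\<close>

definition same_type :: "'a set \<Rightarrow> nat \<Rightarrow> 'a list \<Rightarrow> 'a list \<Rightarrow> bool" where
  "same_type A m s t \<longleftrightarrow> s \<in> tuples (univ U) m \<and> t \<in> tuples (univ U) m \<and>
     (\<forall>Q. definable A m Q \<longrightarrow> (Q s \<longleftrightarrow> Q t))"

lemma same_typeD: "same_type A m s t \<Longrightarrow> definable A m Q \<Longrightarrow> Q s \<longleftrightarrow> Q t"
  unfolding same_type_def by blast

text \<open>Parameters from \<open>A\<close> are allowed in \<open>R\<close>, and the parameter tuple comes first, as in the initial segments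
  of a Morley sequence.\<close>

definition invariant :: "nat \<Rightarrow> ('f + 'a, 'r) fm set \<Rightarrow> 'a set \<Rightarrow> bool" where
  "invariant n p A \<longleftrightarrow> (\<forall>m R s t. definable A (m + n) R \<and> same_type A m s t \<longrightarrow>
     (in_type n p (\<lambda>x. R (s @ x)) \<longleftrightarrow> in_type n p (\<lambda>x. R (t @ x))))"

lemma invariantD:
  "invariant n p A \<Longrightarrow> definable A (m + n) R \<Longrightarrow> same_type A m s t \<Longrightarrow>
     in_type n p (\<lambda>x. R (s @ x)) \<longleftrightarrow> in_type n p (\<lambda>x. R (t @ x))"
  unfolding invariant_def by blast

text \<open>The parameters \<open>b\<close> from \<open>A\<close> that occur in \<open>R\<close> are appended to \<open>s\<close> and \<open>t\<close>; this does not affect the equality of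
  their types over \<open>A\<close>.\<close>

lemma invariant_if_invariant_type:
  assumes p: "p \<in> types n" and A: "A \<subseteq> univ U" and inv: "invariant_type L U A n p"
  shows "invariant n p A"
  unfolding invariant_def
proof (intro allI impI, elim conjE)
  fix m R s t
  assume R: "definable A (m + n) R" and st: "same_type A m s t"
  obtain F where F: "finite F" "F \<subseteq> A" "definable F (m + n) R"
    using definable_finite[OF R] by blast
  obtain b where b: "set b = F" using finite_list[OF F(1)] by blast
  define k where "k = length b"
  have bA: "b \<in> tuples A k" using b F by (auto simp: tuples_def k_def)
  then have bU: "b \<in> tuples (univ U) k" using tuples_mono[OF A] by blast
  have sU: "s \<in> tuples (univ U) m" and tU: "t \<in> tuples (univ U) m"
    using st by (auto simp: same_type_def)
  have "definable ({} \<union> set b) (m + n) R" using F(3) b by simp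
  then obtain R' where R': "definable {} (k + (m + n)) R'"
    "\<And>a. a \<in> tuples (univ U) (m + n) \<Longrightarrow> R a \<longleftrightarrow> R' (b @ a)"
    using definable_parameters bU by metis
  have "definable {} ((k + m) + n) R'" using R'(1) by (simp add: add.assoc)
  from definable_empty[OF definable_swap[OF this]]
  obtain \<phi> where \<phi>: "\<phi> \<in> form L (n + (k + m))"
    "\<And>a. a \<in> tuples (univ U) (n + (k + m)) \<Longrightarrow> R' (drop n a @ take n a) \<longleftrightarrow> holds U a \<phi>"
    by blast
  have in_p: "in_type n p (\<lambda>x. R (s @ x)) \<longleftrightarrow> inst n (b @ s) \<phi> \<in> p" if s: "s \<in> tuples (univ U) m" for s
  proof -
    have bs: "b @ s \<in> tuples (univ U) (k + m)" by (rule tuples_append[OF bU s])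
    have "R (s @ x) \<longleftrightarrow> holds (struct_with U) x (inst n (b @ s) \<phi>)" if x: "x \<in> tuples (univ U) n" for x
    proof -
      have "R (s @ x) \<longleftrightarrow> R' (b @ s @ x)"
        by (rule R'(2)[OF tuples_append[OF s x]])
      also have "\<dots> \<longleftrightarrow> holds U (x @ (b @ s)) \<phi>"
        using \<phi>(2)[OF tuples_append[OF x bs]] tuplesD(1)[OF x] by simp
      also have "\<dots> \<longleftrightarrow> holds (struct_with U) x (inst n (b @ s) \<phi>)"
        by (rule holds_inst[OF \<phi>(1) tuplesD(1)[OF x] tuplesD(1)[OF bs], symmetric])
      finally show ?thesis .
    qed
    then have "in_type n p (\<lambda>x. R (s @ x)) \<longleftrightarrow>
        in_type n p (\<lambda>x. holds (struct_with U) x (inst n (b @ s) \<phi>))"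
      by (rule in_type_cong)
    also have "\<dots> \<longleftrightarrow> inst n (b @ s) \<phi> \<in> p"
      by (rule in_type_holds[OF p inst_form[OF \<phi>(1) bs]])
    finally show ?thesis .
  qed
  have "tp L U A (b @ s) = tp L U A (b @ t)"
  proof -
    have "holds (struct_with U) (b @ s) \<psi> \<longleftrightarrow> holds (struct_with U) (b @ t) \<psi>"
      if "\<psi> \<in> form (lang_with L A) (k + m)" for \<psi>
    proof -
      have "definable A m (\<lambda>a. holds (struct_with U) (b @ a) \<psi>)"
        using definable_append_left[OF definable_holds[OF that] bU] bA by (auto simp: tuples_def)
      then show ?thesis using st unfolding same_type_def by blast
    qed
    moreover have "length (b @ s) = k + m" "length (b @ t) = k + m"
      using sU tU by (simp_all add: tuples_def k_def)
    ultimately show ?thesis unfolding tp_def by auto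
  qed
  then have "inst n (b @ s) \<phi> \<in> p \<longleftrightarrow> inst n (b @ t) \<phi> \<in> p"
    using inv \<phi>(1) tuples_append[OF bU sU] tuples_append[OF bU tU] unfolding invariant_type_def by blast
  then show "in_type n p (\<lambda>x. R (s @ x)) \<longleftrightarrow> in_type n p (\<lambda>x. R (t @ x))"
    using in_p[OF sU] in_p[OF tU] by simp
qed

text \<open>If \<open>R(s, x)\<close> and \<open>\<not>R(t, x)\<close> are both in \<open>q\<close>, they have a common solution \<open>c\<close> in \<open>A\<close>, and \<open>R(y, c)\<close>
  distinguishes the types of \<open>s\<close> and \<open>t\<close> over \<open>A\<close>.\<close>

lemma invariant_if_fin_sat:
  assumes q: "q \<in> types n" and A: "A \<subseteq> univ U" and X: "X \<subseteq> tuples A n" "fin_sat X q"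
  shows "invariant n q A"
proof -
  have "in_type n q (\<lambda>x. R (t @ x))"
    if R: "definable A (m + n) R" and st: "same_type A m s t" and in_q: "in_type n q (\<lambda>x. R (s @ x))"
    for m R s t
  proof (rule ccontr)
    have tU: "t \<in> tuples (univ U) m" "s \<in> tuples (univ U) m" using st by (auto simp: same_type_def)
    have "definable (univ U) n (\<lambda>x. R (t @ x))"
      using definable_append_left[OF R tU(1)] A tuplesD(2)[OF tU(1)] by simp
    moreover assume "\<not> in_type n q (\<lambda>x. R (t @ x))"
    ultimately have "in_type n q (\<lambda>x. \<not> R (t @ x))" using in_type_not[OF q] by blast
    then obtain c where c: "c \<in> X" "R (s @ c)" "\<not> R (t @ c)"
      using in_type_witness2[OF X(2) _ in_q] X(1) tuples_mono[OF A] by blast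
    have cA: "c \<in> tuples A n" using c(1) X(1) by blast
    have "definable A m (\<lambda>y. R (y @ c))"
      using definable_append_right[OF R] cA tuples_mono[OF A] tuplesD(2)[OF cA] by blast
    then show False using st c unfolding same_type_def by blast
  qed
  moreover have "same_type A m t s" if "same_type A m s t" for m s t
    using that unfolding same_type_def by blast
  ultimately show ?thesis unfolding invariant_def by blast
qed

lemma morley_iff:
  "morley_sequence L U A n p a \<longleftrightarrow> (\<forall>i. realizes_over n p (A \<union> set (initial a i)) (a i))"
  unfolding morley_sequence_def realizes_over_def set_initial by simp

lemma morley_tuples: "morley_sequence L U A n p a \<Longrightarrow> a i \<in> tuples (univ U) n"
  by (simp add: morley_sequence_def)

lemma morley_mono: "A \<subseteq> B \<Longrightarrow> morley_sequence L U B n p a \<Longrightarrow> morley_sequence L U A n p a"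
  unfolding morley_iff by (meson realizes_over_mono Un_mono order_refl)

text \<open>By invariance the type over \<open>A\<close> of the first \<open>k\<close> entries decides which formulas over these entries are in
  \<open>p\<close>, and so the type of the first \<open>k + 1\<close> entries.\<close>

lemma morley_same_type:
  assumes p: "p \<in> types n" "invariant n p A" and A: "A \<subseteq> univ U"
    and a: "morley_sequence L U A n p a" and b: "morley_sequence L U A n p b"
  shows "same_type A (k * n) (initial a k) (initial b k)"
proof (induction k)
  case 0
  then show ?case by (simp add: same_type_def tuples_def)
next
  case (Suc k)
  have ini: "initial c j \<in> tuples (univ U) (j * n)" if "morley_sequence L U A n p c" for c j
    using that by (intro initial_tuples) (rule morley_tuples)
  have step: "R (initial c (Suc k)) \<longleftrightarrow> in_type n p (\<lambda>x. R (initial c k @ x))"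
    if R: "definable A (k * n + n) R" and c: "morley_sequence L U A n p c" for R c
  proof -
    have "definable (A \<union> set (initial c k)) n (\<lambda>x. R (initial c k @ x))"
      by (rule definable_append_left[OF R ini[OF c]]) simp
    moreover have "A \<union> set (initial c k) \<subseteq> univ U"
      using A tuplesD(2)[OF ini[OF c]] by simp
    moreover have "realizes_over n p (A \<union> set (initial c k)) (c k)"
      using c unfolding morley_iff by blast
    ultimately show ?thesis
      unfolding initial_Suc using realizes_overD[OF _ p(1)] by blast
  qed
  show ?case
    unfolding same_type_def
  proof (intro conjI allI impI)
    fix R assume "definable A (Suc k * n) R"
    then have R: "definable A (k * n + n) R" by (simp add: add.commute)
    show "R (initial a (Suc k)) \<longleftrightarrow> R (initial b (Suc k))"
      using step[OF R a] step[OF R b] invariantD[OF p(2) R Suc.IH] by simp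
  qed (use ini a b in blast)+
qed

lemma morley_prepend:
  assumes a: "\<And>i. i < k \<Longrightarrow> realizes_over n p (A \<union> set (initial a i)) (a i)"
    and b: "morley_sequence L U (A \<union> set (initial a k)) n p b"
  shows "morley_sequence L U A n p (\<lambda>i. if i < k then a i else b (i - k))" (is "morley_sequence _ _ _ _ _ ?c")
  unfolding morley_iff
proof
  fix i
  show "realizes_over n p (A \<union> set (initial ?c i)) (?c i)"
  proof (cases "i < k")
    case True
    then have "initial ?c i = initial a i" by (intro initial_cong) simp
    then show ?thesis using a True by simp
  next
    case False
    then obtain l where l: "i = k + l" by (metis le_Suc_ex not_less)
    have "initial ?c k = initial a k" by (rule initial_cong) simp
    then have "initial ?c i = initial a k @ initial b l"
      unfolding l initial_add by simp
    moreover have "realizes_over n p (A \<union> set (initial a k) \<union> set (initial b l)) (b l)"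
      using b unfolding morley_iff by blast
    ultimately show ?thesis using l by (simp add: Un_assoc)
  qed
qed

lemma initial_prepend:
  "initial (\<lambda>i. if i < k then a i else b (i - k)) (k + l) = initial a k @ initial b l"
proof -
  have "initial (\<lambda>i. if i < k then a i else b (i - k)) k = initial a k"
    by (rule initial_cong) simp
  then show ?thesis unfolding initial_add by simp
qed

lemma generically_stable_limit:
  assumes p: "p \<in> types n" and gs: "generically_stable L U A n p"
    and a: "morley_sequence L U A n p a" and in_p: "in_type n p Q"
  shows "\<forall>\<^sub>F i in sequentially. Q (a i)"
proof -
  obtain \<psi> where \<psi>: "\<psi> \<in> p" "\<forall>a \<in> tuples (univ U) n. Q a \<longleftrightarrow> holds (struct_with U) a \<psi>"
    using in_p unfolding in_type_def by blast
  have "type_lim L U n (\<lambda>i. tp L U (univ U) (a i)) p"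
    using gs a unfolding generically_stable_def by blast
  moreover have "tp L U (univ U) (a i) \<in> types n" for i
    by (rule tp_in_type_space[OF morley_tuples[OF a]])
  ultimately obtain m where m: "\<forall>i>m. \<psi> \<in> tp L U (univ U) (a i)"
    using type_lim_iff[OF p, of "\<lambda>i. tp L U (univ U) (a i)"] \<psi>(1) by blast
  then have "\<forall>i\<ge>Suc m. Q (a i)"
    using \<psi>(2) morley_tuples[OF a] by (auto simp: tp_def)
  then show ?thesis unfolding eventually_sequentially by blast
qed

text \<open>Convergence is an equivalence because \<open>p\<close> is complete.\<close>

lemma generically_stable_in_type_iff:
  assumes p: "p \<in> types n" and gs: "generically_stable L U A n p"
    and a: "morley_sequence L U A n p a" and Q: "definable (univ U) n Q"
  shows "in_type n p Q \<longleftrightarrow> (\<forall>\<^sub>F i in sequentially. Q (a i))"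
proof
  assume "\<forall>\<^sub>F i in sequentially. Q (a i)"
  then have "\<not> (\<forall>\<^sub>F i in sequentially. \<not> Q (a i))"
    using eventually_conj[of "\<lambda>i. Q (a i)" sequentially "\<lambda>i. \<not> Q (a i)"] by auto
  then show "in_type n p Q"
    using generically_stable_limit[OF p gs a] in_type_not[OF p Q] by blast
qed (rule generically_stable_limit[OF p gs a])

lemma restrict_fin_sat_elem:
  assumes p: "p \<in> types n" and M: "elem_substruct L M U"
  shows "fin_sat (tuples (univ M) n) (type_restrict L n p (univ M))"
  unfolding fin_sat_def
proof (intro allI impI, elim conjE)
  fix q assume q: "finite q" "q \<subseteq> type_restrict L n p (univ M)"
  then have qp: "q \<subseteq> p" and qM: "q \<subseteq> form (lang_with L (univ M)) n"
    by (auto simp: type_restrict_def)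
  have "definable (univ M) n (\<lambda>a. \<forall>\<phi> \<in> q. holds (struct_with U) a \<phi>)"
    using qM by (intro definable_finite_all q definable_holds) blast
  moreover have "\<exists>a \<in> tuples (univ U) n. \<forall>\<phi> \<in> q. holds (struct_with U) a \<phi>"
    using types_fin_sat[OF p] q(1) qp unfolding fin_sat_def by blast
  ultimately show "\<exists>a \<in> tuples (univ M) n. \<forall>\<phi> \<in> q. holds (struct_with U) a \<phi>"
    by (rule definable_elem_substruct[OF M])
qed

end

locale monster = fo_structure L U
  for L :: "('f, 'r) lang" and U :: "('f, 'r, 'a) struct" +
  fixes \<kappa> :: "'k rel"
  assumes card: "Card_order \<kappa>" "(natLeq, \<kappa>) \<in> ordLess"
    and saturated: "saturated L \<kappa> U"
    and homogeneous: "strongly_homogeneous L \<kappa> U"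
begin

lemma small_countable:
  assumes "countable A"
  shows "small \<kappa> A"
proof -
  obtain f :: "_ \<Rightarrow> nat" where "inj_on f A" using assms unfolding countable_def by blast
  then have "(card_of A, card_of (UNIV :: nat set)) \<in> ordLeq"
    using card_of_ordLeq[of A "UNIV :: nat set"] by blast
  then have "(card_of A, natLeq) \<in> ordLeq" using card_of_nat ordLeq_ordIso_trans by blast
  then show ?thesis unfolding small_def using card(2) ordLeq_ordLess_trans by blast
qed

lemma small_Un:
  assumes "small \<kappa> A" "small \<kappa> B"
  shows "small \<kappa> (A \<union> B)"
proof -
  have "(natLeq, card_of (Field \<kappa>)) \<in> ordLeq"
    using ordLess_imp_ordLeq[OF card(2)] card_of_Field_ordIso[OF card(1)]
      ordIso_symmetric ordLeq_ordIso_trans by blast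
  then have "infinite (Field \<kappa>)" using infinite_iff_natLeq_ordLeq by blast
  then show ?thesis
    using assms card_of_Un_ordLess_infinite_Field[OF _ card(1)] unfolding small_def by blast
qed

lemma realization_exists:
  assumes p: "p \<in> types n" and A: "A \<subseteq> univ U" "small \<kappa> A"
  shows "\<exists>a. realizes_over n p A a"
proof -
  have "type_restrict L n p A \<in> type_space L U A n"
    unfolding type_space_def mem_Collect_eq
  proof (intro conjI allI impI ballI)
    fix q assume "finite q \<and> q \<subseteq> type_restrict L n p A"
    then show "\<exists>a \<in> tuples (univ U) n. \<forall>\<phi> \<in> q. holds (struct_with U) a \<phi>"
      using types_fin_sat[OF p] unfolding fin_sat_def type_restrict_def by blast
  next
    fix \<phi> assume \<phi>: "\<phi> \<in> form (lang_with L A) n"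
    then have "Neg \<phi> \<in> form (lang_with L A) n" by (simp add: form_def)
    moreover have "\<phi> \<in> form (lang_with L (univ U)) n" using \<phi> form_mono[OF A(1)] by blast
    then have "\<phi> \<in> p \<or> Neg \<phi> \<in> p" by (rule types_cases[OF p])
    ultimately show "\<phi> \<in> type_restrict L n p A \<or> Neg \<phi> \<in> type_restrict L n p A"
      using \<phi> unfolding type_restrict_def by blast
  qed (simp add: type_restrict_def)
  then show ?thesis
    using saturated A unfolding saturated_def realizes_over_def by blast
qed

lemma morley_exists:
  assumes p: "p \<in> types n" and A: "A \<subseteq> univ U" "small \<kappa> A"
  shows "\<exists>a. morley_sequence L U A n p a"
  unfolding morley_iff
proof (rule dependent_wellorder_choice)
  fix r :: "'a list" and f g :: "nat \<Rightarrow> 'a list" and i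
  assume "\<And>j. j < i \<Longrightarrow> f j = g j"
  then have "initial f i = initial g i" by (rule initial_cong)
  then show "realizes_over n p (A \<union> set (initial f i)) r = realizes_over n p (A \<union> set (initial g i)) r"
    by simp
next
  fix f :: "nat \<Rightarrow> 'a list" and i
  assume "\<And>j. j < i \<Longrightarrow> realizes_over n p (A \<union> set (initial f j)) (f j)"
  then have "set (initial f i) \<subseteq> univ U"
    unfolding set_initial realizes_over_def tuples_def by blast
  then show "\<exists>r. realizes_over n p (A \<union> set (initial f i)) r"
    using A by (intro realization_exists[OF p] small_Un[OF A(2) small_countable]) (auto intro: countable_finite)
qed

text \<open>Since \<open>s N\<close> and \<open>t N\<close> need not extend each other as lists, coherence is expressed by the growing finite
  graphs \<open>set (zip (s N) (t N))\<close>. Their union is the graph of a partial elementary map with countable domain,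
  single-valued because equality is a formula.\<close>

lemma automorphism_between_sequences:
  assumes st: "\<And>N. same_type {} (len N) (s N) (t N)"
    and mono: "mono (\<lambda>N::nat. set (zip (s N) (t N)))"
  shows "\<exists>h. automorphism L U h \<and> (\<forall>N. map h (s N) = t N)"
proof -
  have len: "length (s N) = len N" "length (t N) = len N"
    and sU: "set (s N) \<subseteq> univ U" and tU: "set (t N) \<subseteq> univ U" for N
    using st[of N] by (auto simp: same_type_def tuples_def)
  define G where "G = (\<Union>N. set (zip (s N) (t N)))"
  define A where "A = (\<Union>N. set (s N))"
  have finite_G: "\<exists>N. H \<subseteq> set (zip (s N) (t N))" if "finite H" "H \<subseteq> G" for H
    using that
  proof (induction H)
    case (insert x H)
    then obtain N N' where N: "H \<subseteq> set (zip (s N) (t N))" "x \<in> set (zip (s N') (t N'))"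
      by (auto simp: G_def)
    then show ?case
      using monoD[OF mono, of N "max N N'"] monoD[OF mono, of N' "max N N'"]
      by (intro exI[of _ "max N N'"]) auto
  qed simp
  have functional: "y = y'" if "(x, y) \<in> G" "(x, y') \<in> G" for x y y'
  proof -
    obtain N where N: "(x, y) \<in> set (zip (s N) (t N))" "(x, y') \<in> set (zip (s N) (t N))"
      using finite_G[of "{(x, y), (x, y')}"] \<open>(x, y) \<in> G\<close> \<open>(x, y') \<in> G\<close> by auto
    obtain i where i: "i < len N" "s N ! i = x" "t N ! i = y"
      using N(1) len by (auto simp: in_set_zip)
    obtain j where j: "j < len N" "s N ! j = x" "t N ! j = y'"
      using N(2) len by (auto simp: in_set_zip)
    have "Eq (Var i) (Var j) \<in> form L (len N)" using i j by (simp add: form_def)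
    from definable_form[OF this] have "definable {} (len N) (\<lambda>a. a ! i = a ! j)"
      by (simp add: holds_def)
    then have "s N ! i = s N ! j \<longleftrightarrow> t N ! i = t N ! j"
      using st[of N] unfolding same_type_def by blast
    then show ?thesis using i j by simp
  qed
  define g where "g x = (SOME y. (x, y) \<in> G)" for x
  have g: "g x = y" if "(x, y) \<in> G" for x y
    unfolding g_def using that functional by blast
  have gs: "g (s N ! i) = t N ! i" if "i < len N" for N i
    by (rule g) (use that len in \<open>auto simp: G_def in_set_zip\<close>)
  have "partial_elementary L U A g"
    unfolding partial_elementary_def
  proof (intro conjI allI ballI)
    show "A \<subseteq> univ U" using sU by (auto simp: A_def)
    show "g ` A \<subseteq> univ U"
    proof
      fix y assume "y \<in> g ` A"
      then obtain N i where "i < len N" "y = g (s N ! i)"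
        using len by (auto simp: A_def in_set_conv_nth)
      then show "y \<in> univ U" using gs tU[of N] len nth_mem[of i "t N"] by auto
    qed
    fix m \<phi> l assume \<phi>: "\<phi> \<in> form L m" and l: "l \<in> tuples A m"
    have "(x, g x) \<in> G" if xA: "x \<in> A" for x
    proof -
      obtain N i where "i < len N" "x = s N ! i"
        using xA len by (auto simp: A_def in_set_conv_nth)
      then show ?thesis using gs len by (auto simp: G_def in_set_zip)
    qed
    then have "(\<lambda>x. (x, g x)) ` set l \<subseteq> G" using l by (auto simp: tuples_def)
    then obtain N where N: "(\<lambda>x. (x, g x)) ` set l \<subseteq> set (zip (s N) (t N))"
      using finite_G[of "(\<lambda>x. (x, g x)) ` set l"] by auto
    have "\<exists>i. i < len N \<and> s N ! i = l ! k \<and> t N ! i = g (l ! k)" if "k < m" for k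
    proof -
      have "(l ! k, g (l ! k)) \<in> set (zip (s N) (t N))"
        using N l that by (auto simp: tuples_def)
      then show ?thesis using len by (auto simp: in_set_zip)
    qed
    then obtain f where f: "\<And>k. k < m \<Longrightarrow> f k < len N \<and> s N ! f k = l ! k \<and> t N ! f k = g (l ! k)"
      by metis
    have l_eq: "map (case_sum (nth (s N)) id \<circ> (\<lambda>k. Inl (f k))) [0..<m] = l"
      "map (case_sum (nth (t N)) id \<circ> (\<lambda>k. Inl (f k))) [0..<m] = map g l"
      using f tuplesD(1)[OF l] by (auto intro!: nth_equalityI)
    have "definable {} (len N) (\<lambda>a. holds U (map (case_sum (nth a) id \<circ> (\<lambda>k. Inl (f k))) [0..<m]) \<phi>)"
      by (rule definable_subst[OF definable_form[OF \<phi>, of "{}"]]) (use f in auto)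
    then have "holds U (map (case_sum (nth (s N)) id \<circ> (\<lambda>k. Inl (f k))) [0..<m]) \<phi> \<longleftrightarrow>
        holds U (map (case_sum (nth (t N)) id \<circ> (\<lambda>k. Inl (f k))) [0..<m]) \<phi>"
      using st[of N] unfolding same_type_def by blast
    then show "holds U l \<phi> \<longleftrightarrow> holds U (map g l) \<phi>" unfolding l_eq .
  qed
  moreover have "small \<kappa> A"
    unfolding A_def by (intro small_countable) (auto intro: countable_finite)
  ultimately obtain h where h: "automorphism L U h" "\<forall>x \<in> A. h x = g x"
    using homogeneous unfolding strongly_homogeneous_def by blast
  have "map h (s N) = t N" for N
  proof (rule nth_equalityI)
    fix i assume "i < length (map h (s N))"
    then have i: "i < len N" using len by simp
    then have "s N ! i \<in> set (s N)" using len by simp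
    then have "s N ! i \<in> A" unfolding A_def by blast
    then show "map h (s N) ! i = t N ! i" using h(2) gs i len by simp
  qed (simp add: len)
  then show ?thesis using h(1) by blast
qed

section \<open>Generically stable types over a model\<close>

context
  fixes M :: "('f, 'r, 'a) struct" and n :: nat and p :: "('f + 'a, 'r) fm set"
  assumes M: "elem_substruct L M U" "small \<kappa> (univ M)"
    and p: "p \<in> types n"
    and gs: "generically_stable L U (univ M) n p"
begin

lemma M_sub: "univ M \<subseteq> univ U"
  using M(1) by (simp add: elem_substruct_def substruct_def)

lemma p_invariant: "invariant n p (univ M)"
  using gs by (intro invariant_if_invariant_type[OF p M_sub]) (simp add: generically_stable_def)

lemma coheir_exists:
  "\<exists>r \<in> types n. type_restrict L n p (univ M) \<subseteq> r \<and> fin_sat (tuples (univ M) n) r"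
proof (rule extend_to_type)
  show "tuples (univ M) n \<subseteq> tuples (univ U) n" by (rule tuples_mono[OF M_sub])
  show "type_restrict L n p (univ M) \<subseteq> form (lang_with L (univ U)) n"
    using form_mono[OF M_sub] unfolding type_restrict_def by blast
qed (rule restrict_fin_sat_elem[OF p M(1)])

text \<open>A formula over \<open>M e a\<^sub>0 \<dots> a\<^sub>i\<^sub>-\<^sub>1\<close> cannot separate \<open>a\<^sub>i\<close> from a later \<open>a\<^sub>j\<close>: some \<open>c\<close> in \<open>M\<close> would do the same in
  place of \<open>e\<close>, while \<open>a\<^sub>i\<close> and \<open>a\<^sub>j\<close> have the same type over \<open>M a\<^sub>0 \<dots> a\<^sub>i\<^sub>-\<^sub>1\<close>. If the formula is in \<open>p\<close> it
  holds at some later \<open>a\<^sub>j\<close> by convergence, hence at \<open>a\<^sub>i\<close>.\<close>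

lemma morley_over_coheir:
  assumes a: "morley_sequence L U (univ M) n p a"
    and e: "e \<in> tuples (univ U) n"
    and coheir: "\<And>Q. definable (univ M \<union> (\<Union>i. set (a i))) n Q \<Longrightarrow> Q e \<Longrightarrow> \<exists>c \<in> tuples (univ M) n. Q c"
  shows "morley_sequence L U (univ M \<union> set e) n p a"
  unfolding morley_iff
proof
  fix i
  let ?b = "initial a i"
  have aU: "a j \<in> tuples (univ U) n" for j by (rule morley_tuples[OF a])
  have bU: "?b \<in> tuples (univ U) (i * n)" by (rule initial_tuples[OF aU])
  have b_sub: "set ?b \<subseteq> (\<Union>i. set (a i))" by (auto simp: set_initial)
  have ebU: "e @ ?b \<in> tuples (univ U) (n + i * n)" by (rule tuples_append[OF e bU])
  show "realizes_over n p (univ M \<union> set e \<union> set ?b) (a i)"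
  proof (rule realizes_overI[OF p _ aU])
    show sub: "univ M \<union> set e \<union> set ?b \<subseteq> univ U"
      using M_sub tuplesD(2)[OF e] tuplesD(2)[OF bU] by blast
    fix Q assume Q: "definable (univ M \<union> set e \<union> set ?b) n Q" and in_p: "in_type n p Q"
    have "definable (univ M \<union> set (e @ ?b)) n Q" using Q by (simp add: Un_assoc)
    then obtain R where R: "definable (univ M) (n + i * n + n) R"
      and QR: "\<And>x. x \<in> tuples (univ U) n \<Longrightarrow> Q x \<longleftrightarrow> R ((e @ ?b) @ x)"
      using definable_parameters ebU by metis
    have R': "definable (univ M) (n + (i * n + n)) R" using R by (simp add: add.assoc)
    have same: "Q (a j) \<longrightarrow> Q (a i)" if "i \<le> j" for j
    proof (rule ccontr)
      assume contra: "\<not> (Q (a j) \<longrightarrow> Q (a i))"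
      have def: "definable (univ M \<union> (\<Union>i. set (a i))) n (\<lambda>z. R (z @ ?b @ a l))" for l
        using b_sub by (intro definable_append_right[OF R' tuples_append[OF bU aU]]) auto
      have "definable (univ M \<union> (\<Union>i. set (a i))) n (\<lambda>z. R (z @ ?b @ a j) \<and> \<not> R (z @ ?b @ a i))"
        by (intro definable_conj definable_not def)
      moreover have "R (e @ ?b @ a j) \<and> \<not> R (e @ ?b @ a i)"
        using contra QR[OF aU] by simp
      ultimately obtain c where c: "c \<in> tuples (univ M) n" "R (c @ ?b @ a j)" "\<not> R (c @ ?b @ a i)"
        using coheir[of "\<lambda>z. R (z @ ?b @ a j) \<and> \<not> R (z @ ?b @ a i)"] by blast
      have cbU: "c @ ?b \<in> tuples (univ U) (n + i * n)"
        using tuples_append[OF _ bU] c(1) tuples_mono[OF M_sub] by blast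
      have def: "definable (univ M \<union> set ?b) n (\<lambda>x. R ((c @ ?b) @ x))"
        using c(1) by (intro definable_append_left[OF R cbU]) (auto simp: tuples_def)
      have sub: "univ M \<union> set ?b \<subseteq> univ U" using M_sub tuplesD(2)[OF bU] by blast
      have "realizes_over n p (univ M \<union> set ?b) (a l)" if "i \<le> l" for l
      proof (rule realizes_over_mono)
        show "realizes_over n p (univ M \<union> set (initial a l)) (a l)"
          using a unfolding morley_iff by blast
        show "univ M \<union> set ?b \<subseteq> univ M \<union> set (initial a l)"
          using that by (auto simp: set_initial)
      qed
      then have "R ((c @ ?b) @ a l) \<longleftrightarrow> in_type n p (\<lambda>x. R ((c @ ?b) @ x))" if "i \<le> l" for l
        using realizes_overD[OF _ p sub def] that by blast
      from this[of i] this[of j] show False using c(2,3) \<open>i \<le> j\<close> by simp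
    qed
    have "\<forall>\<^sub>F j in sequentially. Q (a j)"
      by (rule generically_stable_limit[OF p gs a in_p])
    then obtain m where "\<forall>j \<ge> m. Q (a j)" unfolding eventually_sequentially by blast
    then have "Q (a (max i m))" by simp
    then show "Q (a i)" using same[of "max i m"] by simp
  qed
qed

text \<open>The contradiction comes from evaluating \<open>R\<close> with the point \<open>x\<close> placed before and after the parameter
  tuple in a Morley sequence: \<open>e\<close> shows that \<open>R\<close> fails for a point in front of the tuple, and membership in
  \<open>p\<close> says that it holds for a point behind it. A tuple \<open>E\<^sub>0 \<dots> E\<^sub>k\<^sub>-\<^sub>1\<close> behind all of the sequence \<open>a\<close> makes
  this visible to convergence.\<close>

lemma witness_in_M:
  assumes a: "morley_sequence L U (univ M) n p a"
    and Q: "definable (univ M \<union> set (initial a k)) n Q" and in_p: "in_type n p Q"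
  shows "\<exists>c \<in> tuples (univ M) n. Q c"
proof (rule ccontr)
  assume no_witness: "\<not> ?thesis"
  let ?I = "\<Union>i. set (a i)"
  have aU: "a j \<in> tuples (univ U) n" for j by (rule morley_tuples[OF a])
  have MI: "univ M \<union> ?I \<subseteq> univ U" using M_sub tuplesD(2)[OF aU] by blast
  have small: "small \<kappa> (univ M \<union> ?I)"
    by (rule small_Un[OF M(2) small_countable]) (auto intro: countable_finite)
  have kU: "initial a k \<in> tuples (univ U) (k * n)" by (rule initial_tuples[OF aU])
  obtain R where R: "definable (univ M) (k * n + n) R"
    and QR: "\<And>x. x \<in> tuples (univ U) n \<Longrightarrow> Q x \<longleftrightarrow> R (initial a k @ x)"
    using definable_parameters[OF Q kU] by metis
  obtain r where r: "r \<in> types n" "type_restrict L n p (univ M) \<subseteq> r" "fin_sat (tuples (univ M) n) r"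
    using coheir_exists by blast
  obtain e where e: "realizes_over n r (univ M \<union> ?I) e"
    using realization_exists[OF r(1) MI small] by blast
  then have eU: "e \<in> tuples (univ U) n" by (simp add: realizes_over_def)
  have coheir: "\<exists>c \<in> tuples (univ M) n. Q' c" if "definable (univ M \<union> ?I) n Q'" "Q' e" for Q'
    using in_type_witness1[OF r(3) tuples_mono[OF M_sub]] realizes_overD[OF e r(1) MI that(1)] that(2)
    by blast
  have e_p: "realizes_over n p (univ M) e"
    using r(2) realizes_over_mono[OF _ e, of "univ M"]
    unfolding realizes_over_def realizes_def type_restrict_def by blast
  \<comment> \<open>The sequence \<open>e, a 0, a 1, \<dots>\<close>.\<close>
  define c where "c = (\<lambda>i. if i < 1 then e else a (i - 1))"
  have c: "morley_sequence L U (univ M) n p c"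
    unfolding c_def
    by (rule morley_prepend) (use e_p morley_over_coheir[OF a eU coheir] in \<open>simp_all add: initial_Suc\<close>)
  have not_e: "\<not> R (initial a k @ e)"
  proof
    have "set (initial a k) \<subseteq> ?I" by (auto simp: set_initial)
    then have "definable (univ M \<union> ?I) n (\<lambda>x. R (initial a k @ x))"
      by (intro definable_append_left[OF R kU]) blast
    moreover assume "R (initial a k @ e)"
    ultimately obtain d where "d \<in> tuples (univ M) n" "R (initial a k @ d)"
      using coheir by blast
    then show False using no_witness QR tuples_mono[OF M_sub] by blast
  qed
  obtain E where E: "morley_sequence L U (univ M \<union> ?I) n p E"
    using morley_exists[OF p MI small] by blast
  then have EM: "morley_sequence L U (univ M) n p E" by (rule morley_mono[rotated]) simp
  have EU: "initial E k \<in> tuples (univ U) (k * n)"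
    by (rule initial_tuples) (rule morley_tuples[OF E])
  have not_a: "\<not> R (initial E k @ a i)" for i
  proof -
    \<comment> \<open>The sequence \<open>a i, E 0, E 1, \<dots>\<close>.\<close>
    define d where "d = (\<lambda>j. if j < 1 then a i else E (j - 1))"
    have d: "morley_sequence L U (univ M) n p d"
      unfolding d_def
    proof (rule morley_prepend)
      have "realizes_over n p (univ M \<union> set (initial a i)) (a i)" using a unfolding morley_iff by blast
      then have "realizes_over n p (univ M) (a i)" by (rule realizes_over_mono[rotated]) simp
      then show "realizes_over n p (univ M \<union> set (initial (\<lambda>j. a i) j)) (a i)" if "j < 1" for j
        using that by simp
      show "morley_sequence L U (univ M \<union> set (initial (\<lambda>j. a i) 1)) n p E"
        by (rule morley_mono[OF _ E]) (auto simp: initial_Suc)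
    qed
    have "initial c (1 + k) = e @ initial a k" "initial d (1 + k) = a i @ initial E k"
      using initial_prepend[of 1 "\<lambda>_. e" a k] initial_prepend[of 1 "\<lambda>_. a i" E k]
      by (simp_all only: c_def d_def) (simp_all add: initial_def)
    then have same: "same_type (univ M) ((1 + k) * n) (e @ initial a k) (a i @ initial E k)"
      using morley_same_type[OF p p_invariant M_sub c d, of "1 + k"] by (simp only:)
    have def: "definable (univ M) ((1 + k) * n) (\<lambda>l. R (drop n l @ take n l))"
      using definable_swap[OF R] by simp
    from same_typeD[OF same def] show ?thesis
      using not_e tuplesD(1)[OF eU] tuplesD(1)[OF aU] by simp
  qed
  have "same_type (univ M) (k * n) (initial a k) (initial E k)"
    by (rule morley_same_type[OF p p_invariant M_sub a EM])
  then have "in_type n p (\<lambda>x. R (initial a k @ x)) \<longleftrightarrow> in_type n p (\<lambda>x. R (initial E k @ x))"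
    by (rule invariantD[OF p_invariant R])
  moreover have "in_type n p Q \<longleftrightarrow> in_type n p (\<lambda>x. R (initial a k @ x))"
    by (rule in_type_cong) (rule QR)
  ultimately have "\<forall>\<^sub>F i in sequentially. R (initial E k @ a i)"
    using generically_stable_limit[OF p gs a, of "\<lambda>x. R (initial E k @ x)"] in_p by simp
  then show False using not_a by simp
qed

text \<open>Convergence is also needed for formulas with parameters among the \<open>c\<^sub>i\<close> themselves. Therefore \<open>c\<^sub>i\<close> is
  required to satisfy the first \<open>i + 1\<close> formulas in each of the countable types of \<open>p\<close> over
  \<open>I, c\<^sub>0, \<dots>, c\<^sub>j\<^sub>-\<^sub>1\<close> with \<open>j \<le> i\<close>; every formula over \<open>I \<union> C\<close> is listed for some \<open>j\<close>.\<close>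

lemma approximating_sequence:
  assumes L: "countable_lang L" and a: "morley_sequence L U (univ M) n p a"
  shows "\<exists>c. (\<forall>i. c i \<in> tuples (univ M) n) \<and>
    (\<forall>\<psi> \<in> type_restrict L n p ((\<Union>i. set (a i)) \<union> (\<Union>i. set (c i))).
       \<forall>\<^sub>F i in sequentially. holds (struct_with U) (c i) \<psi>)"
proof -
  let ?I = "\<Union>i. set (a i)"
  have aU: "a j \<in> tuples (univ U) n" for j by (rule morley_tuples[OF a])
  define B where "B c j = ?I \<union> set (initial c j)" for c :: "nat \<Rightarrow> 'a list" and j
  define en where "en c j = from_nat_into (type_restrict L n p (B c j))" for c j
  have countable: "countable (type_restrict L n p (B c j))" for c j
  proof -
    have "countable (B c j)"
      unfolding B_def by (intro countable_Un countable_UN) (auto intro: countable_finite)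
    from countable_form_lang_with[OF L this, of n] show ?thesis
      unfolding type_restrict_def by (rule countable_subset[rotated]) blast
  qed
  have en: "en c j l \<in> type_restrict L n p (B c j)" if "set (initial c j) \<subseteq> univ U" for c j l
    unfolding en_def
  proof (rule from_nat_into)
    have B: "B c j \<subseteq> univ U" using that tuplesD(2)[OF aU] unfolding B_def by blast
    \<comment> \<open>Some formula must be in the type, since \<open>from_nat_into\<close> is unspecified on the empty set.\<close>
    let ?\<tau> = "Ex 0 (Eq (Var 0) (Var 0)) :: ('f + 'a, 'r) fm"
    have \<tau>: "?\<tau> \<in> form (lang_with L (B c j)) n" "Neg ?\<tau> \<in> form (lang_with L (B c j)) n"
      by (simp_all add: form_def)
    moreover have "?\<tau> \<in> p \<or> Neg ?\<tau> \<in> p"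
      using types_cases[OF p] \<tau>(1) form_mono[OF B] by blast
    ultimately show "type_restrict L n p (B c j) \<noteq> {}"
      unfolding type_restrict_def by blast
  qed
  have "\<exists>c. \<forall>i. c i \<in> tuples (univ M) n \<and> (\<forall>j \<le> i. \<forall>l \<le> i. holds (struct_with U) (c i) (en c j l))"
  proof (rule dependent_wellorder_choice)
    fix r :: "'a list" and f g :: "nat \<Rightarrow> 'a list" and i
    assume fg: "\<And>j. j < i \<Longrightarrow> f j = g j"
    have "en f j = en g j" if "j \<le> i" for j
    proof -
      have "initial f j = initial g j" by (rule initial_cong) (use fg that in auto)
      then show ?thesis by (simp add: en_def B_def)
    qed
    then show "(r \<in> tuples (univ M) n \<and> (\<forall>j \<le> i. \<forall>l \<le> i. holds (struct_with U) r (en f j l))) =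
        (r \<in> tuples (univ M) n \<and> (\<forall>j \<le> i. \<forall>l \<le> i. holds (struct_with U) r (en g j l)))"
      by metis
  next
    fix c :: "nat \<Rightarrow> 'a list" and i
    assume *: "\<And>j. j < i \<Longrightarrow> c j \<in> tuples (univ M) n \<and> (\<forall>k \<le> j. \<forall>l \<le> j. holds (struct_with U) (c j) (en c k l))"
    have cM: "set (initial c j) \<subseteq> univ M" if "j \<le> i" for j
    proof -
      have "set (c k) \<subseteq> univ M" if "k < j" for k
        using *[of k] \<open>j \<le> i\<close> that tuplesD(2) by fastforce
      then show ?thesis by (auto simp: set_initial)
    qed
    define q where "q = (\<lambda>(j, l). en c j l) ` ({..i} \<times> {..i})"
    have q: "finite q" "q \<subseteq> p" "q \<subseteq> form (lang_with L (univ M \<union> ?I)) n"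
    proof -
      have "en c j l \<in> p \<inter> form (lang_with L (univ M \<union> ?I)) n" if "j \<le> i" for j l
      proof -
        have "B c j \<subseteq> univ M \<union> ?I" using cM[OF that] by (auto simp: B_def)
        moreover have "en c j l \<in> type_restrict L n p (B c j)"
          using en cM[OF that] M_sub by blast
        ultimately show ?thesis using form_mono unfolding type_restrict_def by blast
      qed
      then show "q \<subseteq> p" "q \<subseteq> form (lang_with L (univ M \<union> ?I)) n" by (auto simp: q_def)
    qed (simp add: q_def)
    let ?Q = "\<lambda>x. \<forall>\<phi> \<in> q. holds (struct_with U) x \<phi>"
    have "?I = (\<Union>k. set (initial a k))" by (auto simp: set_initial)
    moreover have "definable (univ M \<union> ?I) n ?Q"
      using q(3) by (intro definable_finite_all q(1) definable_holds) blast
    ultimately have "definable (univ M \<union> (\<Union>k. set (initial a k))) n ?Q" by simp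
    moreover have "mono (\<lambda>k. set (initial a k))"
      by (rule mono_set_initial)
    ultimately obtain k where "definable (univ M \<union> set (initial a k)) n ?Q"
      using definable_directed_union by blast
    moreover have "in_type n p ?Q" by (rule in_type_finite_all[OF p q(1,2)])
    ultimately obtain r where "r \<in> tuples (univ M) n" "?Q r"
      using witness_in_M[OF a] by blast
    then show "\<exists>r. r \<in> tuples (univ M) n \<and> (\<forall>j \<le> i. \<forall>l \<le> i. holds (struct_with U) r (en c j l))"
      by (auto simp: q_def)
  qed
  then obtain c where cM: "\<And>i. c i \<in> tuples (univ M) n"
    and c: "\<And>i j l. j \<le> i \<Longrightarrow> l \<le> i \<Longrightarrow> holds (struct_with U) (c i) (en c j l)"
    by blast
  have "\<forall>\<^sub>F i in sequentially. holds (struct_with U) (c i) \<psi>"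
    if \<psi>: "\<psi> \<in> type_restrict L n p (?I \<union> (\<Union>i. set (c i)))" for \<psi>
  proof -
    have "(\<Union>i. set (c i)) = (\<Union>k. set (initial c k))" by (auto simp: set_initial)
    then have "\<psi> \<in> form (lang_with L (?I \<union> (\<Union>k. set (initial c k)))) n"
      using \<psi> by (simp add: type_restrict_def)
    moreover have "mono (\<lambda>k. set (initial c k))"
      by (rule mono_set_initial)
    ultimately obtain j where "\<psi> \<in> form (lang_with L (B c j)) n"
      using form_directed_union unfolding B_def by blast
    then have "\<psi> \<in> type_restrict L n p (B c j)" using \<psi> by (simp add: type_restrict_def)
    then obtain l where "en c j l = \<psi>"
      unfolding en_def using from_nat_into_surj[OF countable] by blast
    then have "holds (struct_with U) (c i) \<psi>" if "max j l \<le> i" for i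
      using c[of j i l] that by simp
    then show ?thesis unfolding eventually_sequentially by blast
  qed
  then show ?thesis using cM by blast
qed

text \<open>Two global types that agree on \<open>I \<union> C\<close> are compared here through Morley sequences: \<open>p\<close> is invariant over \<open>M\<close>
  and \<open>q\<close> over the smaller set \<open>C\<close>, so \<open>I, e\<close> and \<open>I, E\<close> are only known to have the same type over \<open>C\<close>. An
  automorphism that fixes \<open>I\<close> need not fix \<open>p\<close>, but \<open>I\<close> and \<open>E\<close> together detect the contradiction.\<close>

lemma limit_of_sequence_in_M:
  assumes L: "countable_lang L"
  shows "\<exists>c. (\<forall>i. c i \<in> tuples (univ M) n) \<and> type_lim L U n (\<lambda>i. tp L U (univ U) (c i)) p"
proof -
  obtain a where a: "morley_sequence L U (univ M) n p a"
    using morley_exists[OF p M_sub M(2)] by blast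
  obtain c where cM: "\<And>i. c i \<in> tuples (univ M) n"
    and c: "\<And>\<psi>. \<psi> \<in> type_restrict L n p ((\<Union>i. set (a i)) \<union> (\<Union>i. set (c i))) \<Longrightarrow>
      \<forall>\<^sub>F i in sequentially. holds (struct_with U) (c i) \<psi>"
    using approximating_sequence[OF L a] by blast
  let ?I = "\<Union>i. set (a i)" and ?C = "\<Union>i. set (c i)"
  have aU: "a j \<in> tuples (univ U) n" for j by (rule morley_tuples[OF a])
  have cU: "c i \<in> tuples (univ U) n" for i using cM tuples_mono[OF M_sub] by blast
  have CM: "?C \<subseteq> univ M" using tuplesD(2)[OF cM] by blast
  have IU: "?I \<subseteq> univ U" using tuplesD(2)[OF aU] by blast
  have CU: "?C \<subseteq> univ U" using CM M_sub by blast
  have countable_I: "countable ?I" by (auto intro: countable_finite)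
  have "\<exists>m. \<forall>i>m. \<psi> \<in> tp L U (univ U) (c i)" if \<psi>: "\<psi> \<in> p" for \<psi>
  proof (rule ccontr)
    have \<psi>U: "\<psi> \<in> form (lang_with L (univ U)) n" using \<psi> p by (auto simp: types_iff)
    assume neg: "\<not> (\<exists>m. \<forall>i>m. \<psi> \<in> tp L U (univ U) (c i))"
    then have "\<exists>i>m. \<not> holds (struct_with U) (c i) \<psi>" for m
      using \<psi>U tuplesD(1)[OF cU] by (auto simp: tp_def)
    then have freq: "\<exists>\<^sub>F i in sequentially. \<not> holds (struct_with U) (c i) \<psi>"
      unfolding frequently_sequentially by (meson less_imp_le)
    \<comment> \<open>\<open>S\<close> is the limit filter of the subsequence of those \<open>c i\<close> where \<open>\<psi>\<close> fails; \<open>q\<close> is an accumulation point.\<close>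
    define S where "S = {\<theta> \<in> form (lang_with L (univ U)) n.
      \<forall>\<^sub>F i in sequentially. \<not> holds (struct_with U) (c i) \<psi> \<longrightarrow> holds (struct_with U) (c i) \<theta>}"
    have "fin_sat (range c) S"
      unfolding fin_sat_def
    proof (intro allI impI, elim conjE)
      fix s assume s: "finite s" "s \<subseteq> S"
      have "\<forall>\<^sub>F i in sequentially. \<forall>\<theta> \<in> s. \<not> holds (struct_with U) (c i) \<psi> \<longrightarrow> holds (struct_with U) (c i) \<theta>"
        using s by (intro eventually_ball_finite) (auto simp: S_def)
      from frequently_eventually_frequently[OF freq this] show "\<exists>x \<in> range c. \<forall>\<theta> \<in> s. holds (struct_with U) x \<theta>"
        by (auto dest!: frequently_ex)
    qed
    moreover have "range c \<subseteq> tuples (univ U) n" using cU by blast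
    moreover have "S \<subseteq> form (lang_with L (univ U)) n" by (auto simp: S_def)
    ultimately obtain q where q: "q \<in> types n" "S \<subseteq> q" "fin_sat (range c) q"
      using extend_to_type by blast
    have q_inv: "invariant n q ?C"
      by (rule invariant_if_fin_sat[OF q(1) CU _ q(3)]) (auto simp: tuples_def tuplesD(1)[OF cU])
    have "Neg \<psi> \<in> S" using \<psi>U by (auto simp: S_def form_def holds_def)
    then have not_\<psi>: "Neg \<psi> \<in> q" using q(2) by blast
    have agree: "type_restrict L n p (?I \<union> ?C) = type_restrict L n q (?I \<union> ?C)"
    proof -
      have sub: "form (lang_with L (?I \<union> ?C)) n \<subseteq> form (lang_with L (univ U)) n"
        using IU CU by (intro form_mono) blast
      have pq: "\<theta> \<in> q" if "\<theta> \<in> p" "\<theta> \<in> form (lang_with L (?I \<union> ?C)) n" for \<theta>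
      proof -
        have "\<forall>\<^sub>F i in sequentially. holds (struct_with U) (c i) \<theta>"
          using c that by (simp add: type_restrict_def)
        then have "\<theta> \<in> S" using sub that(2) by (auto simp: S_def elim: eventually_mono)
        then show ?thesis using q(2) by blast
      qed
      have qp: "\<theta> \<in> p" if "\<theta> \<in> q" "\<theta> \<in> form (lang_with L (?I \<union> ?C)) n" for \<theta>
      proof (rule ccontr)
        assume "\<theta> \<notin> p"
        then have "Neg \<theta> \<in> p" using types_cases[OF p] that(2) sub by blast
        then have "Neg \<theta> \<in> q" using that(2) by (intro pq) (auto simp: form_def)
        then show False using types_not_both[OF q(1) that(1)] by blast
      qed
      show ?thesis using pq qp unfolding type_restrict_def by blast
    qed
    have realizes_q: "realizes_over n q A x" if "realizes_over n p A x" "A \<subseteq> ?I \<union> ?C" for A x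
      using that(1) form_mono[OF that(2)] agree
      unfolding realizes_over_def realizes_def type_restrict_def by blast
    have a_q: "realizes_over n q (?C \<union> set (initial a i)) (a i)" for i
    proof (rule realizes_q)
      have "realizes_over n p (univ M \<union> set (initial a i)) (a i)" using a unfolding morley_iff by blast
      then show "realizes_over n p (?C \<union> set (initial a i)) (a i)"
        by (rule realizes_over_mono[rotated]) (use CM in blast)
      show "?C \<union> set (initial a i) \<subseteq> ?I \<union> ?C" by (auto simp: set_initial)
    qed
    then have a_morley_q: "morley_sequence L U ?C n q a" unfolding morley_iff by blast
    have a_p: "realizes_over n p (univ M \<union> set (initial a i)) (a i)" for i
      using a unfolding morley_iff by blast

    have "definable (univ U) n (\<lambda>x. holds (struct_with U) x \<psi>)" by (rule definable_holds[OF \<psi>U])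
    then obtain F where F: "finite F" "F \<subseteq> univ U" "definable F n (\<lambda>x. holds (struct_with U) x \<psi>)"
      using definable_finite by metis
    obtain b where b: "set b = F" using finite_list[OF F(1)] by blast
    define m where "m = length b"
    have bU: "b \<in> tuples (univ U) m" using b F(2) by (simp add: tuples_def m_def)
    have "definable ({} \<union> set b) n (\<lambda>x. holds (struct_with U) x \<psi>)" using F(3) b by simp
    then obtain R where R: "definable {} (m + n) R"
      and \<psi>R: "\<And>x. x \<in> tuples (univ U) n \<Longrightarrow> holds (struct_with U) x \<psi> \<longleftrightarrow> R (b @ x)"
      using definable_parameters bU by metis

    have MI: "univ M \<union> ?I \<subseteq> univ U" "small \<kappa> (univ M \<union> ?I)"
      using M_sub IU small_Un[OF M(2) small_countable[OF countable_I]] by auto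
    have MIb: "univ M \<union> ?I \<union> set b \<subseteq> univ U" "small \<kappa> (univ M \<union> ?I \<union> set b)"
      using MI(1) tuplesD(2)[OF bU] small_Un[OF MI(2) small_countable[OF countable_finite]] by auto
    obtain e where e: "morley_sequence L U (univ M \<union> ?I \<union> set b) n q e"
      using morley_exists[OF q(1) MIb] by blast
    obtain E where E: "morley_sequence L U (univ M \<union> ?I) n p E"
      using morley_exists[OF p MI] by blast
    have EM: "morley_sequence L U (univ M) n p E"
      by (rule morley_mono[OF _ E]) blast
    have eU: "e i \<in> tuples (univ U) n" and EU: "E i \<in> tuples (univ U) n" for i
      using morley_tuples[OF e] morley_tuples[OF E] by auto

    define s where "s N = initial a N @ initial e N" for N
    define t where "t N = initial a N @ initial E N" for N
    have st: "same_type {} ((N + N) * n) (s N) (t N)" for N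
    proof -
      have init: "set (initial a N) \<subseteq> ?I" by (auto simp: set_initial)
      have "morley_sequence L U ?C n q (\<lambda>i. if i < N then a i else e (i - N))"
        using init CM by (intro morley_prepend a_q morley_mono[OF _ e]) blast
      note morley_same_type[OF q(1) q_inv CU this a_morley_q, of "N + N"]
      then have es: "same_type ?C ((N + N) * n) (s N) (initial a (N + N))"
        by (simp only: s_def initial_prepend[of N a e])
      have "morley_sequence L U (univ M) n p (\<lambda>i. if i < N then a i else E (i - N))"
        using init by (intro morley_prepend a_p morley_mono[OF _ E]) blast
      note morley_same_type[OF p p_invariant M_sub this a, of "N + N"]
      then have et: "same_type (univ M) ((N + N) * n) (t N) (initial a (N + N))"
        by (simp only: t_def initial_prepend[of N a E])
      show ?thesis
        using es et definable_mono[of "{}" ?C] definable_mono[of "{}" "univ M"]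
        unfolding same_type_def by blast
    qed
    have "mono (\<lambda>N. set (zip (s N) (t N)))"
    proof (rule incseq_SucI)
      fix N
      have "length (initial e N) = length (initial E N)"
        using tuplesD(1)[OF initial_tuples[OF eU]] tuplesD(1)[OF initial_tuples[OF EU]] by simp
      then show "set (zip (s N) (t N)) \<subseteq> set (zip (s (Suc N)) (t (Suc N)))"
        by (auto simp: s_def t_def initial_Suc zip_append)
    qed
    from automorphism_between_sequences[where len = "\<lambda>N. (N + N) * n", OF st this]
    obtain h where h: "automorphism L U h" and hst: "\<And>N. map h (s N) = t N"
      by blast
    have h_init: "map h (initial a N) = initial a N" "map h (initial e N) = initial E N" for N
      using hst[of N] by (simp_all add: s_def t_def)
    have ha: "map h (a i) = a i" and he: "map h (e i) = E i" for i
      using h_init(1)[of "Suc i"] h_init(1)[of i] h_init(2)[of "Suc i"] h_init(2)[of i]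
      by (simp_all add: initial_Suc)
    \<comment> \<open>\<open>h\<close> may move \<open>p\<close>, so only the formula is moved: \<open>a\<close> and \<open>E\<close> are Morley sequences in \<open>p\<close> itself.\<close>
    define b' where "b' = map h b"
    have b'U: "b' \<in> tuples (univ U) m"
      using bU h by (auto simp: b'_def tuples_def automorphism_def bij_betw_def)
    have move: "R (b' @ map h x) \<longleftrightarrow> R (b @ x)" if "x \<in> tuples (univ U) n" for x
      using definable_automorphism[OF h R tuples_append[OF bU that]] by (simp add: b'_def)
    have def: "definable (univ U) n (\<lambda>x. R (b' @ x))"
      using tuplesD(2)[OF b'U] by (intro definable_append_left[OF R b'U]) simp

    have "in_type n p (\<lambda>x. holds (struct_with U) x \<psi>)"
      using in_type_holds[OF p \<psi>U] \<psi> by blast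
    then have "\<forall>\<^sub>F i in sequentially. holds (struct_with U) (a i) \<psi>"
      by (rule generically_stable_limit[OF p gs a])
    then have "\<forall>\<^sub>F i in sequentially. R (b' @ a i)"
      using \<psi>R[OF aU] move[OF aU] ha by simp
    then have "in_type n p (\<lambda>x. R (b' @ x))"
      unfolding generically_stable_in_type_iff[OF p gs a def] .
    then have ev: "\<forall>\<^sub>F i in sequentially. R (b' @ E i)"
      by (rule generically_stable_limit[OF p gs EM])
    have "\<not> R (b' @ E i)" for i
    proof -
      have "realizes_over n q (univ M \<union> ?I \<union> set b \<union> set (initial e i)) (e i)"
        using e unfolding morley_iff by blast
      then have ei: "realizes_over n q (set b) (e i)" by (rule realizes_over_mono[rotated]) blast
      have "\<not> in_type n q (\<lambda>x. holds (struct_with U) x \<psi>)"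
      proof
        assume "in_type n q (\<lambda>x. holds (struct_with U) x \<psi>)"
        then have "\<psi> \<in> q" using in_type_holds[OF q(1) \<psi>U] by blast
        then show False using types_not_both[OF q(1)] not_\<psi> by blast
      qed
      moreover have "definable (set b) n (\<lambda>x. holds (struct_with U) x \<psi>)" using F(3) b by simp
      ultimately have "\<not> holds (struct_with U) (e i) \<psi>"
        using realizes_overD[OF ei q(1) tuplesD(2)[OF bU]] by blast
      then show ?thesis using \<psi>R[OF eU] move[OF eU] he by simp
    qed
    then show False using ev by simp
  qed
  then have "type_lim L U n (\<lambda>i. tp L U (univ U) (c i)) p"
    by (subst type_lim_iff[OF p tp_in_type_space[OF cU]]) blast
  then show ?thesis using cM by blast
qed

end

end

theorem mainTheorem1:
  fixes L :: "('f, 'r) lang"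
    and T :: "('f, 'r) fm set"
    and \<kappa> :: "'k rel"
    and U M :: "('f, 'r, 'a) struct"
    and n :: nat
    and p :: "('f + 'a, 'r) fm set"
  assumes "countable_lang L"
    and "complete_theory L T"
    and "monster_model L T \<kappa> U"
    and "elem_substruct L M U"
    and "small \<kappa> (univ M)"
    and "p \<in> type_space L U (univ U) n"
    and "generically_stable L U (univ M) n p"
  shows "\<exists>a :: nat \<Rightarrow> 'a list. (\<forall>i. a i \<in> tuples (univ M) n) \<and>
           type_lim L U n (\<lambda>i. tp L U (univ U) (a i)) p"
proof -
  interpret monster L U \<kappa>
    using assms(3) unfolding monster_model_def by unfold_locales auto
  show ?thesis
    by (rule limit_of_sequence_in_M[OF assms(4-7) assms(1)])
qed

end
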